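(* Let $G$ be a connected abelian Lie group which is not the trivial group, let $T$ be its (unique) maximal compact subgroup, and let $d=\dim(G/T)$. Then $d_{gr}G=d_mG=d+1$.
   Context: For a topological group $G$, $d_{gr}G$ (resp. $d_mG$) denotes the minimal number of elements of a subset $A\subseteq G$ such that the subgroup (resp. subsemigroup) of $G$ generated by $A$ is dense in $G$. *)

theory Defs
  imports "HOL-Analysis.Analysis" "HOL-Library.Extended_Nat"
begin

text \<open>C^k via iterated directional (Frechet) derivatives; meant for open S.\<close>
primrec Ck :: "nat \<Rightarrow> ('a::real_normed_vector \<Rightarrow> 'b::real_normed_vector) \<Rightarrow> 'a set \<Rightarrow> bool" where
  "Ck 0 f S = continuous_on S f"
| "Ck (Suc k) f S = (f differentiable_on S \<and> (\<forall>v. Ck k (\<lambda>x. frechet_derivative f (at x) v) S))"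

definition smooth_on :: "'a::real_normed_vector set \<Rightarrow> ('a \<Rightarrow> 'b::real_normed_vector) \<Rightarrow> bool" where
  "smooth_on S f \<longleftrightarrow> open S \<and> (\<forall>k. Ck k f S)"

definition is_chart :: "'g::topological_space set \<Rightarrow> ('g \<Rightarrow> 'e::euclidean_space) \<Rightarrow> bool" where
  "is_chart U \<phi> \<longleftrightarrow> open U \<and> inj_on \<phi> U \<and> continuous_on U \<phi> \<and> open (\<phi> ` U)
      \<and> continuous_on (\<phi> ` U) (inv_into U \<phi>)"

definition lie_group_atlas :: "('g::{topological_ab_group_add,t2_space} set \<times> ('g \<Rightarrow> 'e::euclidean_space)) set \<Rightarrow> bool" where
  "lie_group_atlas A \<longleftrightarrow>
     (\<forall>(U,\<phi>)\<in>A. is_chart U \<phi>) \<and>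
     (\<Union>(U,\<phi>)\<in>A. U) = UNIV \<and>
     (\<forall>(U,\<phi>)\<in>A. \<forall>(V,\<psi>)\<in>A. smooth_on (\<phi> ` (U \<inter> V)) (\<lambda>a. \<psi> (inv_into U \<phi> a))) \<and>
     (\<forall>(U,\<phi>)\<in>A. \<forall>(V,\<psi>)\<in>A. \<forall>(W,\<eta>)\<in>A.
        smooth_on {(a,b). a \<in> \<phi> ` U \<and> b \<in> \<psi> ` V \<and> inv_into U \<phi> a + inv_into V \<psi> b \<in> W}
                  (\<lambda>(a,b). \<eta> (inv_into U \<phi> a + inv_into V \<psi> b))) \<and>
     (\<forall>(U,\<phi>)\<in>A. \<forall>(V,\<psi>)\<in>A.
        smooth_on {a. a \<in> \<phi> ` U \<and> - inv_into U \<phi> a \<in> V} (\<lambda>a. \<psi> (- inv_into U \<phi> a)))"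

definition is_subgroup :: "'g::ab_group_add set \<Rightarrow> bool" where
  "is_subgroup H \<longleftrightarrow> 0 \<in> H \<and> (\<forall>x\<in>H. \<forall>y\<in>H. x + y \<in> H) \<and> (\<forall>x\<in>H. - x \<in> H)"

definition maximal_compact_subgroup :: "'g::{topological_ab_group_add} set \<Rightarrow> bool" where
  "maximal_compact_subgroup T \<longleftrightarrow> is_subgroup T \<and> compact T \<and>
     (\<forall>K. is_subgroup K \<and> compact K \<and> T \<subseteq> K \<longrightarrow> K = T)"

definition quotient_top :: "'g::{topological_ab_group_add} set \<Rightarrow> 'g set topology" where
  "quotient_top T = topology (\<lambda>U. U \<subseteq> range (\<lambda>x. (+) x ` T) \<and> open (\<Union>U))"

definition locally_euclidean_dim :: "'a topology \<Rightarrow> nat \<Rightarrow> bool" where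
  "locally_euclidean_dim X d \<longleftrightarrow>
     (\<forall>p\<in>topspace X. \<exists>U V. openin X U \<and> p \<in> U \<and> openin (Euclidean_space d) V \<and>
        subtopology X U homeomorphic_space subtopology (Euclidean_space d) V)"

inductive_set subgroup_gen :: "'g::ab_group_add set \<Rightarrow> 'g set" for A where
  zero: "0 \<in> subgroup_gen A"
| gen: "a \<in> A \<Longrightarrow> a \<in> subgroup_gen A"
| diff: "x \<in> subgroup_gen A \<Longrightarrow> y \<in> subgroup_gen A \<Longrightarrow> x - y \<in> subgroup_gen A"

inductive_set subsemigroup_gen :: "'g::ab_group_add set \<Rightarrow> 'g set" for A where
  gen: "a \<in> A \<Longrightarrow> a \<in> subsemigroup_gen A"
| add: "x \<in> subsemigroup_gen A \<Longrightarrow> y \<in> subsemigroup_gen A \<Longrightarrow> x + y \<in> subsemigroup_gen A"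

definition ecard :: "'a set \<Rightarrow> enat" where
  "ecard A = (if finite A then enat (card A) else \<infinity>)"

definition d_gr :: "'g::{topological_ab_group_add} itself \<Rightarrow> enat" where
  "d_gr _ = Inf {ecard A | A :: 'g set. closure (subgroup_gen A) = UNIV}"

definition d_m :: "'g::{topological_ab_group_add} itself \<Rightarrow> enat" where
  "d_m _ = Inf {ecard A | A :: 'g set. closure (subsemigroup_gen A) = UNIV}"

end

theory Submission
  imports Defs "HOL-Homology.Invariance_of_Domain"
begin

text \<open>
  In a chart around 0 the group law is x + y + O(2), so doubling is a local map with derivative 2 at its
  fixed point. Its Koenigs linearization e(v) = lim (doubling)^k (v / 2^k) turns vector addition into
  the group law, by commutativity, and extends to a continuous open surjective homomorphism E from the
  model space onto G. Let V be the span of ker E. Then E(V) is compact, and the functionals vanishing on V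
  descend to G, which forces every compact subgroup into E(V); hence T = E(V) and d is the codimension
  of V.

  Given at most d generators, some nonzero functional vanishes on V and on lifts of all generators but
  one; it maps the generated subgroup to a discrete subgroup of the reals, so that subgroup is not dense.
  Conversely, extend a basis of V taken from ker E by e_1, ..., e_d to a basis of the model space. The
  images of the e_i together with one vector whose coordinates are, up to sign, positive and with 1
  linearly independent over the integers generate a dense subsemigroup, by Kronecker's theorem. The
  coordinate at e_i is negative, so that only nonnegative multiples of e_i are needed.
\<close>

subsection \<open>Linearization of a local abelian group\<close>

lemma differentiable_imp_locally_lipschitz_at:
  fixes h :: "'a::real_normed_vector \<Rightarrow> 'b::real_normed_vector"
  assumes "h differentiable (at z)"
  obtains d B where "d > 0" "B > 0" "\<And>y. norm (y - z) < d \<Longrightarrow> norm (h y - h z) \<le> B * norm (y - z)"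
proof -
  obtain h' where h': "(h has_derivative h') (at z)"
    using assms by (auto simp: differentiable_def)
  then have bl: "bounded_linear h'"
    by (rule has_derivative_bounded_linear)
  obtain K where K: "K > 0" "\<And>x. norm (h' x) \<le> norm x * K"
    using bounded_linear.pos_bounded[OF bl] by blast
  obtain d where d: "d > 0" "\<And>y. norm (y - z) < d \<Longrightarrow> norm (h y - h z - h' (y - z)) \<le> 1 * norm (y - z)"
    using h' unfolding has_derivative_at_alt by (meson zero_less_one)
  show ?thesis
  proof
    fix y assume y: "norm (y - z) < d"
    have "norm (h y - h z) \<le> norm (h y - h z - h' (y - z)) + norm (h' (y - z))"
      by (metis diff_add_cancel norm_triangle_ineq)
    also have "\<dots> \<le> 1 * norm (y - z) + norm (y - z) * K"
      using d(2)[OF y] K(2) by (intro add_mono) auto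
    finally show "norm (h y - h z) \<le> (1 + K) * norm (y - z)"
      by (simp add: algebra_simps)
  qed (use K d in auto)
qed

text \<open>Each directional derivative of \<open>g\<close> along a basis vector is itself
  differentiable at \<open>z0\<close>, hence Lipschitz there. Expanding in the basis bounds the
  operator norm of the derivative minus \<open>L\<close> by \<open>C * R\<close> on the ball of
  radius \<open>R\<close>, and the mean value inequality turns this into the estimate on increments.
  The radius \<open>R\<close> is kept separate from \<open>r\<close> so that the error improves on
  small balls.\<close>

lemma smooth_on_linearization:
  fixes g :: "'a::euclidean_space \<Rightarrow> 'b::real_normed_vector"
  assumes g: "smooth_on S g" and z0: "z0 \<in> S"
  defines "L \<equiv> frechet_derivative g (at z0)"
  obtains r C where "r > 0" "C > 0" "cball z0 r \<subseteq> S" "(g has_derivative L) (at z0)"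
    "\<And>z z' R. \<lbrakk>norm (z - z0) \<le> R; norm (z' - z0) \<le> R; R \<le> r\<rbrakk>
       \<Longrightarrow> norm (g z - g z' - L (z - z')) \<le> C * R * norm (z - z')"
proof -
  have "open S" and Ck: "\<And>k. Ck k g S"
    using g by (auto simp: smooth_on_def)
  define h where "h v z = frechet_derivative g (at z) v" for v z
  have dg: "(g has_derivative (\<lambda>v. h v z)) (at z)" if "z \<in> S" for z
  proof -
    have "g differentiable (at z)"
      using Ck[of "Suc 0"] that \<open>open S\<close>
      unfolding Ck.simps differentiable_on_def by (metis at_within_open)
    then show ?thesis by (simp add: frechet_derivative_works h_def)
  qed
  have lin: "linear (\<lambda>v. h v z)" if "z \<in> S" for z
    using dg[OF that] has_derivative_linear by blast
  have "\<forall>b. \<exists>d B. d > 0 \<and> B > 0 \<and> (\<forall>y. norm (y - z0) < d \<longrightarrow> norm (h b y - h b z0) \<le> B * norm (y - z0))"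
  proof
    fix b
    have "h b differentiable (at z0)"
      using Ck[of "Suc (Suc 0)"] z0 \<open>open S\<close>
      unfolding Ck.simps differentiable_on_def h_def[abs_def] by (metis at_within_open)
    then show "\<exists>d B. d > 0 \<and> B > 0 \<and> (\<forall>y. norm (y - z0) < d \<longrightarrow> norm (h b y - h b z0) \<le> B * norm (y - z0))"
      by (rule differentiable_imp_locally_lipschitz_at) (intro exI conjI allI impI)
  qed
  then obtain d B where dB: "\<forall>b. d b > 0 \<and> B b > 0 \<and> (\<forall>y. norm (y - z0) < d b \<longrightarrow> norm (h b y - h b z0) \<le> B b * norm (y - z0))"
    unfolding choice_iff by (elim exE)
  then have d: "\<And>b. d b > 0" and B: "\<And>b. B b > 0"
    and hB: "\<And>b y. norm (y - z0) < d b \<Longrightarrow> norm (h b y - h b z0) \<le> B b * norm (y - z0)"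
    by blast+
  obtain r0 where r0: "r0 > 0" "cball z0 r0 \<subseteq> S"
    using \<open>open S\<close> z0 open_contains_cball by blast
  define dm where "dm = Min (d ` (Basis :: 'a set))"
  have dm: "dm > 0" "\<And>b. b \<in> Basis \<Longrightarrow> dm \<le> d b"
    using d by (auto simp: dm_def)
  \<comment> \<open>Halving \<open>dm\<close> makes \<open>r\<close> strictly smaller than every
    \<open>d b\<close>, as the Lipschitz bounds \<open>hB\<close> require on the closed
    ball.\<close>
  define r where "r = min r0 (dm / 2)"
  have r: "r > 0" "r < dm" "r \<le> r0"
    using r0 dm by (auto simp: r_def)
  define C where "C = (\<Sum>b\<in>(Basis :: 'a set). B b)"
  have C: "C > 0"
    unfolding C_def using B by (intro sum_pos) auto
  have onb: "norm (h v z - h v z0) \<le> C * R * norm v" if "norm (z - z0) \<le> R" "R \<le> r" for v z R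
  proof -
    have zS: "z \<in> S"
      using that r r0 by (auto simp: subset_iff dist_norm norm_minus_commute)
    have expand: "h v y = (\<Sum>b\<in>Basis. (v \<bullet> b) *\<^sub>R h b y)" if "y \<in> S" for y
    proof -
      have "h (\<Sum>b\<in>Basis. (v \<bullet> b) *\<^sub>R b) y = (\<Sum>b\<in>Basis. (v \<bullet> b) *\<^sub>R h b y)"
        by (simp add: linear_sum[OF lin[OF that]] linear_cmul[OF lin[OF that]])
      then show ?thesis by (simp add: euclidean_representation)
    qed
    have "norm (h v z - h v z0) = norm (\<Sum>b\<in>Basis. (v \<bullet> b) *\<^sub>R (h b z - h b z0))"
      using expand[OF zS] expand[OF z0] by (simp add: sum_subtractf scaleR_diff_right)
    also have "\<dots> \<le> (\<Sum>b\<in>Basis. norm v * (B b * R))"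
    proof (rule sum_norm_le)
      fix b :: 'a assume b: "b \<in> Basis"
      have "norm (h b z - h b z0) \<le> B b * norm (z - z0)"
        using hB[of z b] that r dm(2)[OF b] by linarith
      also have "\<dots> \<le> B b * R"
        using that B[of b] by (simp add: mult_left_mono)
      finally show "norm ((v \<bullet> b) *\<^sub>R (h b z - h b z0)) \<le> norm v * (B b * R)"
        using Basis_le_norm[OF b, of v] by (auto intro: mult_mono)
    qed
    also have "\<dots> = C * R * norm v"
      by (simp add: C_def sum_distrib_left sum_distrib_right mult_ac)
    finally show ?thesis .
  qed
  show ?thesis
  proof (rule that)
    show "r > 0" "C > 0" by fact+
    show "cball z0 r \<subseteq> S" using r r0 by (meson order_trans subset_cball)
    show "(g has_derivative L) (at z0)" using dg[OF z0] by (simp add: L_def h_def[abs_def])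
    fix z z' R assume *: "norm (z - z0) \<le> R" "norm (z' - z0) \<le> R" "R \<le> r"
    have L: "L = (\<lambda>v. h v z0)" by (simp add: L_def h_def[abs_def])
    \<comment> \<open>The mean value inequality is applied to \<open>g - L\<close>, whose derivative
      at \<open>y\<close> is the derivative of \<open>g\<close> at \<open>y\<close> minus
      \<open>L\<close>.\<close>
    have "norm ((g z - L z) - (g z' - L z')) \<le> (C * R) * norm (z - z')"
    proof (rule differentiable_bound[of "cball z0 R"])
      fix y assume y: "y \<in> cball z0 R"
      then have yR: "norm (y - z0) \<le> R" by (simp add: dist_norm norm_minus_commute)
      have yS: "y \<in> S" using y * r r0 by (meson order_trans subset_cball subsetD)
      have bl: "bounded_linear L"
        using dg[OF z0] L has_derivative_bounded_linear by blast
      show "((\<lambda>y. g y - L y) has_derivative (\<lambda>v. h v y - L v)) (at y within cball z0 R)"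
        by (intro has_derivative_diff has_derivative_at_withinI[OF dg[OF yS]]
            bounded_linear_imp_has_derivative bl)
      show "onorm (\<lambda>v. h v y - L v) \<le> C * R"
        unfolding L using onb[OF yR *(3)] by (rule onorm_le)
    qed (use * in \<open>auto simp: dist_norm norm_minus_commute\<close>)
    moreover have "L (z - z') = L z - L z'"
      unfolding L using lin[OF z0] by (rule linear_diff)
    moreover have "(g z - L z) - (g z' - L z') = g z - g z' - (L z - L z')" by simp
    ultimately show "norm (g z - g z' - L (z - z')) \<le> C * R * norm (z - z')" by simp
  qed
qed

text \<open>\<open>F\<close> stands for a group law in coordinates centred at its neutral element,
  and \<open>lip\<close> says that it differs from addition by second order terms. Put D y =
  \<open>F y y\<close>. The maps v \<mapsto> D^k (v / 2^k) form a Cauchy sequence, because halving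
  divides a quadratic error by 4 while D multiplies it by little more than 2. Hypothesis
  \<open>medial\<close> says that D respects \<open>F\<close>, so the defect of additivity contracts
  in the same way and vanishes in the limit.\<close>

lemma koenigs_linearization:
  fixes F :: "'e::banach \<Rightarrow> 'e \<Rightarrow> 'e"
  assumes r: "r > 0" and C: "C > 0" and F0: "F 0 0 = 0"
    and lip: "\<And>x y x' y' R. \<lbrakk>norm x \<le> R; norm y \<le> R; norm x' \<le> R; norm y' \<le> R; R \<le> r\<rbrakk>
      \<Longrightarrow> norm (F x y - F x' y' - ((x - x') + (y - y'))) \<le> C * R * (norm (x - x') + norm (y - y'))"
    and medial: "\<And>a b. \<lbrakk>norm a \<le> r; norm b \<le> r; norm (F a a) \<le> r; norm (F b b) \<le> r; norm (F a b) \<le> r\<rbrakk>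
      \<Longrightarrow> F (F a a) (F b b) = F (F a b) (F a b)"
  obtains \<rho> e K where "\<rho> > 0" "\<And>v. norm v < \<rho> \<Longrightarrow> norm (e v) \<le> r"
    "\<And>v. norm v < \<rho> \<Longrightarrow> norm (e v - v) \<le> norm v / 2"
    "\<And>v w. \<lbrakk>norm v < \<rho>; norm w < \<rho>; norm (v + w) < \<rho>\<rbrakk> \<Longrightarrow> e (v + w) = F (e v) (e w)"
    "\<And>v w. \<lbrakk>norm v < \<rho>; norm w < \<rho>\<rbrakk> \<Longrightarrow> norm (e v - e w) \<le> K * norm (v - w)"
proof -
  \<comment> \<open>The bound \<open>r / 8\<close> keeps every argument of \<open>F\<close> that
    occurs below in the ball of radius \<open>r\<close>; the bound \<open>1 / (16 * C)\<close> makes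
    the Lipschitz factor of \<open>F\<close> at these scales at most 9/8.\<close>
  define \<rho> where "\<rho> = min (r / 8) (1 / (16 * C))"
  have \<rho>: "\<rho> > 0" "\<rho> \<le> r / 8" "C * \<rho> \<le> 1 / 16"
    using r C by (auto simp: \<rho>_def min_def field_simps)
  have Cle: "C * norm v \<le> 1 / 16" if "norm v < \<rho>" for v :: 'e
    using that \<rho>(3) C by (smt (verit) mult_left_mono)
  have half: "norm (v /\<^sub>R 2) < \<rho>" if "norm v < \<rho>" for v :: 'e
    using that \<rho>(1) by simp
  have Flip: "norm (F x y - F x' y') \<le> (1 + C * R) * (norm (x - x') + norm (y - y'))"
    if "norm x \<le> R" "norm y \<le> R" "norm x' \<le> R" "norm y' \<le> R" "R \<le> r" for x y x' y' R
  proof -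
    have "norm (F x y - F x' y') \<le> norm (F x y - F x' y' - ((x - x') + (y - y'))) + norm ((x - x') + (y - y'))"
      by (metis diff_add_cancel norm_triangle_ineq)
    also have "\<dots> \<le> C * R * (norm (x - x') + norm (y - y')) + (norm (x - x') + norm (y - y'))"
      using lip[OF that] norm_triangle_ineq by (rule add_mono)
    finally show ?thesis by (simp add: algebra_simps)
  qed
  \<comment> \<open>\<open>x k v\<close> is D^k (v / 2^k), with the recursion peeling off the
    outermost doubling.\<close>
  define x where "x = rec_nat (\<lambda>v. v) (\<lambda>_ f v. F (f (v /\<^sub>R 2)) (f (v /\<^sub>R 2)))"
  have x0: "x 0 v = v" and xS: "x (Suc k) v = F (x k (v /\<^sub>R 2)) (x k (v /\<^sub>R 2))" for k v
    by (simp_all add: x_def)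
  \<comment> \<open>In the inductive step, twice the error at v/2 contributes 2 C |v|^2 and the last
    doubling adds another 2 C |v|^2. The second bound follows from the first by C |v| \<le>
    1/16.\<close>
  have x_near: "norm (x k v - v) \<le> 4 * C * (norm v)\<^sup>2 \<and> norm (x k v - v) \<le> norm v / 4" if "norm v < \<rho>" for k v
    using that
  proof (induction k arbitrary: v)
    case 0
    then show ?case using C by (simp add: x0)
  next
    case (Suc k)
    define y where "y = x k (v /\<^sub>R 2)"
    have y: "norm (y - v /\<^sub>R 2) \<le> 4 * C * (norm (v /\<^sub>R 2))\<^sup>2" "norm (y - v /\<^sub>R 2) \<le> norm (v /\<^sub>R 2) / 4"
      using Suc.IH[OF half[OF Suc.prems]] by (auto simp: y_def)
    have y_le: "norm y \<le> norm v"
      using y(2) norm_triangle_ineq[of "y - v /\<^sub>R 2" "v /\<^sub>R 2"] 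
      by simp (use norm_ge_zero[of v] in linarith)
    have "norm v \<le> r" using Suc.prems \<rho> by linarith
    then have "norm (F y y - F 0 0 - ((y - 0) + (y - 0))) \<le> C * norm v * (norm (y - 0) + norm (y - 0))"
      by (intro lip) (use y_le in auto)
    also have "\<dots> \<le> C * norm v * (norm v + norm v)"
      using y_le C by (intro mult_left_mono) auto
    finally have 1: "norm (F y y - (y + y)) \<le> 2 * C * (norm v)\<^sup>2"
      by (simp add: F0 power2_eq_square)
    have "norm ((y + y) - v) = norm (2 *\<^sub>R (y - v /\<^sub>R 2))"
      by (simp add: algebra_simps scaleR_2)
    also have "\<dots> = 2 * norm (y - v /\<^sub>R 2)" by simp
    also have "\<dots> \<le> 2 * C * (norm v)\<^sup>2"
      using y(1) by (simp add: power2_eq_square)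
    finally have 2: "norm ((y + y) - v) \<le> 2 * C * (norm v)\<^sup>2" .
    have 3: "norm (F y y - v) \<le> 4 * C * (norm v)\<^sup>2"
      using 1 2 norm_triangle_ineq[of "F y y - (y + y)" "(y + y) - v"] by simp
    have "C * norm v * norm v \<le> 1 / 16 * norm v"
      using Cle[OF Suc.prems] by (intro mult_right_mono) auto
    with 3 show ?case
      by (simp add: xS y_def power2_eq_square)
  qed
  have x_le: "norm (x k v) \<le> 5 / 4 * norm v" if "norm v < \<rho>" for k v
    using x_near[OF that, of k] norm_triangle_ineq[of "x k v - v" v] by simp
  have x_r: "norm (x k v) \<le> r" if "norm v < \<rho>" for k v
    using x_le[OF that, of k] that \<rho> r by linarith
  \<comment> \<open>Used with \<sigma> = \<rho>/2, where it gives 2\<rho> \<le> r/4 and so places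
    the products in the domain of \<open>medial\<close> and \<open>Flip\<close>.\<close>
  have F_le: "norm (F (x k v) (x k w)) \<le> 4 * \<sigma>" if "norm v < \<sigma>" "norm w < \<sigma>" "\<sigma> \<le> \<rho>" for k v w \<sigma>
  proof -
    have v: "norm (x k v) \<le> 5 / 4 * \<sigma>" and w: "norm (x k w) \<le> 5 / 4 * \<sigma>"
      using x_le[of v k] x_le[of w k] that by linarith+
    have \<sigma>: "\<sigma> > 0" using that(1) norm_ge_zero[of v] by linarith
    have "norm (F (x k v) (x k w) - F 0 0) \<le> (1 + C * (5 / 4 * \<sigma>)) * (norm (x k v - 0) + norm (x k w - 0))"
      by (rule Flip) (use v w that \<sigma> \<rho> in auto)
    then have "norm (F (x k v) (x k w)) \<le> (1 + C * (5 / 4 * \<sigma>)) * (norm (x k v) + norm (x k w))"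
      by (simp add: F0)
    also have "\<dots> \<le> (1 + 5 / 64) * (5 / 4 * \<sigma> + 5 / 4 * \<sigma>)"
    proof (intro mult_mono add_mono v w order_refl)
      have "C * \<sigma> \<le> C * \<rho>" using that C by (intro mult_left_mono) auto
      then show "C * (5 / 4 * \<sigma>) \<le> 5 / 64" using \<rho>(3) by simp
    qed (use \<sigma> in auto)
    also have "\<dots> \<le> 4 * \<sigma>" using \<sigma> by simp
    finally show ?thesis .
  qed
  \<comment> \<open>Passing from v to v/2 divides the quadratic bound by 4, and doubling costs at
    most a factor 2 * 17/16; the product 17/32 is below 3/4.\<close>
  have x_step: "norm (x (Suc k) v - x k v) \<le> 4 * C * (norm v)\<^sup>2 * (3 / 4) ^ k" if "norm v < \<rho>" for k v
    using that
  proof (induction k arbitrary: v)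
    case 0
    then show ?case using x_near[of v "Suc 0"] by (simp add: x0)
  next
    case (Suc k)
    let ?u = "v /\<^sub>R 2"
    have u: "norm ?u < \<rho>" "norm ?u = norm v / 2" using half[OF Suc.prems] by auto
    have le: "norm (x j ?u) \<le> norm v" for j
      using x_le[OF u(1), of j] u(2) norm_ge_zero[of v] by linarith
    have "norm (x (Suc (Suc k)) v - x (Suc k) v)
        \<le> (1 + C * norm v) * (norm (x (Suc k) ?u - x k ?u) + norm (x (Suc k) ?u - x k ?u))"
      unfolding xS[of "Suc k" v] xS[of k v] by (rule Flip) (use le Suc.prems \<rho> in auto)
    also have "\<dots> \<le> (1 + 1 / 16) * (4 * C * (norm ?u)\<^sup>2 * (3 / 4) ^ k + 4 * C * (norm ?u)\<^sup>2 * (3 / 4) ^ k)"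
      using Suc.IH[OF u(1)] Cle[OF Suc.prems] by (intro mult_mono add_mono) auto
    also have "\<dots> = 17 / 32 * (4 * C * (norm v)\<^sup>2 * (3 / 4) ^ k)"
      using u(2) by (simp add: power2_eq_square)
    also have "\<dots> \<le> 3 / 4 * (4 * C * (norm v)\<^sup>2 * (3 / 4) ^ k)"
      using C by (intro mult_right_mono) auto
    finally show ?case by simp
  qed
  \<comment> \<open>By \<open>medial\<close>, the defect at v, w is the difference of two doublings
    whose arguments differ by the defect at v/2, w/2. The contraction factor is 2 * 9/8 / 4 =
    9/16.\<close>
  have x_add: "norm (x k (v + w) - F (x k v) (x k w)) \<le> C * (norm v + norm w)\<^sup>2 * (3 / 4) ^ k"
    if "norm v < \<rho>" "norm w < \<rho>" "norm (v + w) < \<rho>" for k v w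
    using that
  proof (induction k arbitrary: v w)
    case 0
    have "norm (F v w - F 0 0 - ((v - 0) + (w - 0))) \<le> C * (norm v + norm w) * (norm (v - 0) + norm (w - 0))"
      by (rule lip) (use 0 \<rho> in auto)
    then show ?case
      by (simp add: x0 F0 power2_eq_square norm_minus_commute)
  next
    case (Suc k)
    let ?v = "v /\<^sub>R 2" and ?w = "w /\<^sub>R 2"
    let ?a = "x k ?v" and ?b = "x k ?w"
    have n: "norm ?v < \<rho> / 2" "norm ?w < \<rho> / 2" "norm (?v + ?w) < \<rho> / 2"
    proof -
      have "?v + ?w = (v + w) /\<^sub>R 2" by (simp add: scaleR_add_right)
      then show "norm (?v + ?w) < \<rho> / 2" using Suc.prems(3) by simp
    qed (use Suc.prems in simp_all)
    have n': "norm ?v < \<rho>" "norm ?w < \<rho>" "norm (?v + ?w) < \<rho>"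
      using n \<rho>(1) by linarith+
    have F2: "norm (F (x k v') (x k w')) \<le> 2 * \<rho>" if "norm v' < \<rho> / 2" "norm w' < \<rho> / 2" for v' w'
      using F_le[of v' "\<rho> / 2" w' k] that \<rho>(1) by simp
    have med: "F (F ?a ?a) (F ?b ?b) = F (F ?a ?b) (F ?a ?b)"
    proof (rule medial)
      show "norm ?a \<le> r" "norm ?b \<le> r" using x_r n' by blast+
      show "norm (F ?a ?a) \<le> r" "norm (F ?b ?b) \<le> r" "norm (F ?a ?b) \<le> r"
        using F2[of ?v ?v] F2[of ?w ?w] F2[of ?v ?w] n \<rho> by linarith+
    qed
    have e1: "(v + w) /\<^sub>R 2 = ?v + ?w" by (simp add: scaleR_add_right)
    have "norm (x (Suc k) (v + w) - F (x (Suc k) v) (x (Suc k) w))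
        = norm (F (x k (?v + ?w)) (x k (?v + ?w)) - F (F ?a ?b) (F ?a ?b))"
      unfolding xS e1 med ..
    also have "\<dots> \<le> (1 + C * (2 * \<rho>)) * (norm (x k (?v + ?w) - F ?a ?b) + norm (x k (?v + ?w) - F ?a ?b))"
    proof (rule Flip)
      show "norm (x k (?v + ?w)) \<le> 2 * \<rho>"
        using x_le[OF n'(3), of k] n' \<rho> by linarith
      then show "norm (x k (?v + ?w)) \<le> 2 * \<rho>" .
      show "norm (F ?a ?b) \<le> 2 * \<rho>" using F2 n by blast
      then show "norm (F ?a ?b) \<le> 2 * \<rho>" .
      show "2 * \<rho> \<le> r" using \<rho> r by linarith
    qed
    also have "\<dots> \<le> (1 + 1 / 8) * (C * (norm ?v + norm ?w)\<^sup>2 * (3 / 4) ^ k + C * (norm ?v + norm ?w)\<^sup>2 * (3 / 4) ^ k)"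
      using Suc.IH[OF n'] \<rho>(3) by (intro mult_mono add_mono) auto
    also have "\<dots> = 9 / 16 * (C * (norm v + norm w)\<^sup>2 * (3 / 4) ^ k)"
      by (simp add: power2_eq_square field_simps)
    also have "\<dots> \<le> 3 / 4 * (C * (norm v + norm w)\<^sup>2 * (3 / 4) ^ k)"
      using C by (intro mult_right_mono) auto
    finally show ?case by simp
  qed
  \<comment> \<open>Convergence is shown only for \<open>norm v < \<rho>\<close>; elsewhere the
    value of \<open>e\<close> has no meaning.\<close>
  define e where "e v = lim (\<lambda>k. x k v)" for v
  have lim: "(\<lambda>k. x k v) \<longlonglongrightarrow> e v" if "norm v < \<rho>" for v
  proof -
    have "summable (\<lambda>k. x (Suc k) v - x k v)"
    proof (rule summable_comparison_test'[where N = 0])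
      show "summable (\<lambda>k. 4 * C * (norm v)\<^sup>2 * (3 / 4 :: real) ^ k)"
        by (intro summable_mult summable_geometric) auto
    qed (use x_step[OF that] in auto)
    then have "convergent (\<lambda>n. \<Sum>k<n. x (Suc k) v - x k v)"
      by (simp add: summable_iff_convergent)
    then have "convergent (\<lambda>n. (x n v - x 0 v) + x 0 v)"
      using sum_lessThan_telescope[of "\<lambda>k. x k v"] by (intro convergent_add convergent_const) simp
    then show ?thesis
      by (simp add: e_def convergent_LIMSEQ_iff)
  qed
  have e_r: "norm (e v) \<le> r" if "norm v < \<rho>" for v
    using tendsto_norm[OF lim[OF that]] x_r[OF that] by (intro LIMSEQ_le_const2) auto
  have e_near: "norm (e v - v) \<le> norm v / 4" if "norm v < \<rho>" for v
    using tendsto_norm[OF tendsto_diff[OF lim[OF that] tendsto_const[of v]]] x_near[OF that]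
    by (intro LIMSEQ_le_const2) auto
  have e_add: "e (v + w) = F (e v) (e w)" if vw: "norm v < \<rho>" "norm w < \<rho>" "norm (v + w) < \<rho>" for v w
  proof -
    have "(\<lambda>k. F (x k v) (x k w)) \<longlonglongrightarrow> F (e v) (e w)"
    proof (rule LIM_zero_cancel, rule Lim_null_comparison)
      show "\<forall>\<^sub>F k in sequentially. norm (F (x k v) (x k w) - F (e v) (e w))
          \<le> (1 + C * r) * (norm (x k v - e v) + norm (x k w - e w))"
        using Flip x_r vw e_r by auto
      have "(\<lambda>k. (1 + C * r) * (norm (x k v - e v) + norm (x k w - e w))) \<longlonglongrightarrow> (1 + C * r) * (norm (e v - e v) + norm (e w - e w))"
        by (intro tendsto_intros lim vw)
      then show "(\<lambda>k. (1 + C * r) * (norm (x k v - e v) + norm (x k w - e w))) \<longlonglongrightarrow> 0" by simp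
    qed
    then have "(\<lambda>k. x k (v + w) - F (x k v) (x k w)) \<longlonglongrightarrow> e (v + w) - F (e v) (e w)"
      by (intro tendsto_diff lim vw)
    moreover have "(\<lambda>k. x k (v + w) - F (x k v) (x k w)) \<longlonglongrightarrow> 0"
    proof (rule Lim_null_comparison)
      show "\<forall>\<^sub>F k in sequentially. norm (x k (v + w) - F (x k v) (x k w)) \<le> C * (norm v + norm w)\<^sup>2 * (3 / 4) ^ k"
        using x_add[OF vw] by auto
      show "(\<lambda>k. C * (norm v + norm w)\<^sup>2 * (3 / 4 :: real) ^ k) \<longlonglongrightarrow> 0"
        by (intro tendsto_mult_right_zero LIMSEQ_power_zero) auto
    qed
    ultimately show ?thesis
      using LIMSEQ_unique by fastforce
  qed
  show ?thesis
  \<comment> \<open>On half the radius, v - w stays within \<rho>. The Lipschitz bound then compares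
    e v = F (e w) (e (v - w)) with e w = F (e w) 0.\<close>
  proof (rule that[of "\<rho> / 2" e "(1 + C * r) * (5 / 4)"])
    fix v w :: 'e assume vw: "norm v < \<rho> / 2" "norm w < \<rho> / 2"
    have d: "norm (v - w) < \<rho>"
      using vw norm_triangle_ineq4[of v w] by linarith
    have v': "norm v < \<rho>" and w': "norm w < \<rho>" and z': "norm (0 :: 'e) < \<rho>"
      using vw \<rho>(1) by auto
    have "e v = F (e w) (e (v - w))" using e_add[OF w' d] v' by simp
    moreover have "e w = F (e w) (e 0)" using e_add[OF w' z'] w' by simp
    moreover have "e 0 = 0" using e_near[OF z'] by simp
    ultimately have "norm (e v - e w) = norm (F (e w) (e (v - w)) - F (e w) 0)" by simp
    also have "\<dots> \<le> (1 + C * r) * (norm (e w - e w) + norm (e (v - w) - 0))"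
      by (rule Flip) (use e_r d w' r in auto)
    also have "\<dots> \<le> (1 + C * r) * (5 / 4 * norm (v - w))"
      using e_near[OF d] norm_triangle_ineq[of "e (v - w) - (v - w)" "v - w"] C r
      by (intro mult_left_mono) auto
    finally show "norm (e v - e w) \<le> (1 + C * r) * (5 / 4) * norm (v - w)"
      by (simp only: mult.assoc)
  next
    fix v :: 'e assume v: "norm v < \<rho> / 2"
    then have v': "norm v < \<rho>" using \<rho>(1) by linarith
    show "norm (e v) \<le> r" using e_r v' by blast
    show "norm (e v - v) \<le> norm v / 2" using e_near[OF v'] norm_ge_zero[of v] by linarith
  next
    fix v w :: 'e assume "norm v < \<rho> / 2" "norm w < \<rho> / 2" "norm (v + w) < \<rho> / 2"
    then show "e (v + w) = F (e v) (e w)" using \<rho>(1) by (intro e_add) linarith+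
  qed (use \<rho>(1) in auto)
qed

text \<open>The linearization \<open>e\<close> of the group law in a chart around 0, followed by the
  inverse chart, is additive. If \<open>f v = 0\<close> then \<open>e v = 0\<close>, and since
  \<open>e v\<close> is within \<open>norm v / 2\<close> of \<open>v\<close> this forces
  \<open>v = 0\<close>; additivity upgrades this to local injectivity. Invariance of domain makes
  \<open>e\<close> open, and the chart carries openness over to \<open>f\<close>.\<close>

lemma lie_group_atlas_local_exponential:
  fixes A :: "('g::{topological_ab_group_add,t2_space} set \<times> ('g \<Rightarrow> 'e::euclidean_space)) set"
  assumes A: "lie_group_atlas A"
  obtains \<rho> and f :: "'e \<Rightarrow> 'g" where "\<rho> > 0" "continuous_on (ball 0 \<rho>) f"
    "\<And>S. \<lbrakk>open S; S \<subseteq> ball 0 \<rho>\<rbrakk> \<Longrightarrow> open (f ` S)"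
    "\<And>v w. \<lbrakk>norm v < \<rho>; norm w < \<rho>; norm (v + w) < \<rho>\<rbrakk> \<Longrightarrow> f (v + w) = f v + f w"
proof -
  have charts: "\<forall>(U,\<phi>)\<in>A. is_chart U \<phi>"
    using A unfolding lie_group_atlas_def by (elim conjE)
  have "(\<Union>(U,\<phi>)\<in>A. U) = UNIV"
    using A unfolding lie_group_atlas_def by (elim conjE)
  then have "0 \<in> (\<Union>(U,\<phi>)\<in>A. U)" by simp
  then obtain U \<phi> where UA: "(U, \<phi>) \<in> A" and U0: "0 \<in> U" by auto
  have chart: "is_chart U \<phi>"
    using bspec[OF charts UA] by simp
  define \<psi> where "\<psi> = inv_into U \<phi>"
  define p where "p = \<phi> 0"
  define S where "S = {(a, b). a \<in> \<phi> ` U \<and> b \<in> \<phi> ` U \<and> \<psi> a + \<psi> b \<in> U}"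
  define g where "g = (\<lambda>(a, b). \<phi> (\<psi> a + \<psi> b))"
  have "\<forall>(U,\<phi>)\<in>A. \<forall>(V,\<psi>)\<in>A. \<forall>(W,\<eta>)\<in>A.
        smooth_on {(a,b). a \<in> \<phi> ` U \<and> b \<in> \<psi> ` V \<and> inv_into U \<phi> a + inv_into V \<psi> b \<in> W}
                  (\<lambda>(a,b). \<eta> (inv_into U \<phi> a + inv_into V \<psi> b))"
    using A unfolding lie_group_atlas_def by (elim conjE)
  then have smooth: "smooth_on S g"
    unfolding S_def g_def \<psi>_def by - ((drule bspec[OF _ UA], simp only: prod.case)+)
  have U: "open U" and inj: "inj_on \<phi> U" and cont: "continuous_on U \<phi>" and V: "open (\<phi> ` U)"
    and cont': "continuous_on (\<phi> ` U) \<psi>"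
    using chart by (auto simp: is_chart_def \<psi>_def)
  have \<psi>\<phi>: "\<psi> (\<phi> x) = x" if "x \<in> U" for x
    using inj that by (simp add: \<psi>_def)
  have \<phi>\<psi>: "\<phi> (\<psi> a) = a" "\<psi> a \<in> U" if "a \<in> \<phi> ` U" for a
    using that by (auto simp: \<psi>\<phi>)
  have p: "p \<in> \<phi> ` U" "\<psi> p = 0"
    using U0 by (auto simp: p_def \<psi>\<phi>)
  have ppS: "(p, p) \<in> S" using p U0 by (simp add: S_def)
  define L where "L = frechet_derivative g (at (p, p))"
  obtain r0 C0 where r0: "r0 > 0" "C0 > 0" "cball (p, p) r0 \<subseteq> S" and dg: "(g has_derivative L) (at (p, p))"
    and lin0: "\<And>z z' R. \<lbrakk>norm (z - (p, p)) \<le> R; norm (z' - (p, p)) \<le> R; R \<le> r0\<rbrakk>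
       \<Longrightarrow> norm (g z - g z' - L (z - z')) \<le> C0 * R * norm (z - z')"
    using smooth_on_linearization[OF smooth ppS] unfolding L_def by blast
  \<comment> \<open>Since \<open>p\<close> is the coordinate of the neutral element,
    \<open>g (a, p) = a\<close>. Together with the symmetric case this shows that the derivative of
    the group law at the identity is vector addition.\<close>
  have L1: "L (u, 0) = u" for u
  proof -
    have "((\<lambda>a. (a, p)) has_derivative (\<lambda>u. (u, 0))) (at p)"
      by (intro derivative_intros)
    then have "((\<lambda>a. g (a, p)) has_derivative (\<lambda>u. L (u, 0))) (at p)"
      using dg by (rule has_derivative_compose)
    then have "((\<lambda>a. a) has_derivative (\<lambda>u. L (u, 0))) (at p)"
      by (rule has_derivative_transform_within_open[OF _ V p(1)]) (simp add: g_def p \<phi>\<psi>)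
    then show ?thesis
      using has_derivative_unique[OF has_derivative_ident] by metis
  qed
  have L2: "L (0, u) = u" for u
  proof -
    have "((\<lambda>a. (p, a)) has_derivative (\<lambda>u. (0, u))) (at p)"
      by (intro derivative_intros)
    then have "((\<lambda>a. g (p, a)) has_derivative (\<lambda>u. L (0, u))) (at p)"
      using dg by (rule has_derivative_compose)
    then have "((\<lambda>a. a) has_derivative (\<lambda>u. L (0, u))) (at p)"
      by (rule has_derivative_transform_within_open[OF _ V p(1)]) (simp add: g_def p \<phi>\<psi>)
    then show ?thesis
      using has_derivative_unique[OF has_derivative_ident] by metis
  qed
  have L: "L (u, v) = u + v" for u v
  proof -
    have "L ((u, 0) + (0, v)) = L (u, 0) + L (0, v)"
      using has_derivative_linear[OF dg] by (rule linear_add)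
    then show ?thesis by (simp add: L1 L2)
  qed
  \<comment> \<open>Recentred coordinates: \<open>s\<close> is the inverse chart with the neutral
    element moved to the origin, and \<open>F\<close> is the group law read in them.\<close>
  define s where "s x = \<psi> (p + x)" for x
  define F where "F x y = \<phi> (s x + s y) - p" for x y
  have Fg: "F x y = g (p + x, p + y) - p" for x y
    by (simp add: F_def g_def s_def)
  \<comment> \<open>A pair of vectors of norm at most R has norm at most 2 R; hence the halved
    radius here and the constant \<open>2 * C0\<close> below.\<close>
  define r where "r = r0 / 2"
  have inS: "(p + x, p + y) \<in> S" if "norm x \<le> r" "norm y \<le> r" for x y
  proof -
    have "norm (x, y) \<le> r0"
      using norm_Pair_le[of x y] that unfolding r_def by linarith
    moreover have "dist (p, p) (p + x, p + y) = norm (x, y)"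
      by (simp add: dist_Pair_Pair dist_norm norm_Pair)
    ultimately show ?thesis using r0(3) by (metis mem_cball subsetD)
  qed
  have s_dom: "p + x \<in> \<phi> ` U" if "norm x \<le> r" for x
    using inS[OF that that] by (simp add: S_def)
  have sF: "s (F x y) = s x + s y" if "norm x \<le> r" "norm y \<le> r" for x y
    using inS[OF that] by (simp add: S_def F_def s_def \<psi>\<phi>)
  have s0: "s 0 = 0" by (simp add: s_def p)
  obtain \<rho> e K where \<rho>: "\<rho> > 0" and e_r: "\<And>v. norm v < \<rho> \<Longrightarrow> norm (e v) \<le> r"
    and e_near: "\<And>v. norm v < \<rho> \<Longrightarrow> norm (e v - v) \<le> norm v / 2"
    and e_add: "\<And>v w. \<lbrakk>norm v < \<rho>; norm w < \<rho>; norm (v + w) < \<rho>\<rbrakk> \<Longrightarrow> e (v + w) = F (e v) (e w)"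
    and e_lip: "\<And>v w. \<lbrakk>norm v < \<rho>; norm w < \<rho>\<rbrakk> \<Longrightarrow> norm (e v - e w) \<le> K * norm (v - w)"
  proof (rule koenigs_linearization[of r "2 * C0" F])
    show "r > 0" "2 * C0 > 0" using r0 by (auto simp: r_def)
    show "F 0 0 = 0" by (simp add: F_def s0 p_def)
  next
    fix x y x' y' :: 'e and R
    assume *: "norm x \<le> R" "norm y \<le> R" "norm x' \<le> R" "norm y' \<le> R" "R \<le> r"
    have R: "R \<ge> 0" using *(1) norm_ge_zero order_trans by blast
    have "norm (g (p + x, p + y) - g (p + x', p + y') - L ((p + x, p + y) - (p + x', p + y')))
        \<le> C0 * (2 * R) * norm ((p + x, p + y) - (p + x', p + y'))"
      by (rule lin0) (use * norm_Pair_le[of x y] norm_Pair_le[of x' y'] in \<open>auto simp: r_def\<close>)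
    also have "\<dots> \<le> C0 * (2 * R) * (norm (x - x') + norm (y - y'))"
      using norm_Pair_le[of "x - x'" "y - y'"] r0 R by (intro mult_left_mono) auto
    finally show "norm (F x y - F x' y' - (x - x' + (y - y'))) \<le> 2 * C0 * R * (norm (x - x') + norm (y - y'))"
      by (simp add: Fg L mult_ac)
  next
    fix a b :: 'e
    assume "norm a \<le> r" "norm b \<le> r" "norm (F a a) \<le> r" "norm (F b b) \<le> r" "norm (F a b) \<le> r"
    then have "s (F a a) + s (F b b) = s (F a b) + s (F a b)"
      by (simp add: sF add_ac)
    then show "F (F a a) (F b b) = F (F a b) (F a b)"
      by (simp add: F_def[of "F a a"] F_def[of "F a b"])
  qed (rule that)
  define f where "f v = s (e v)" for v
  have f_add: "f (v + w) = f v + f w" if "norm v < \<rho>" "norm w < \<rho>" "norm (v + w) < \<rho>" for v w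
    using that by (simp add: f_def e_add sF e_r)
  have f_ker: "v = 0" if "norm v < \<rho>" "f v = 0" for v
  proof -
    have "\<phi> (\<psi> (p + e v)) = \<phi> 0" using that(2) by (simp add: f_def s_def)
    then have "e v = 0" using \<phi>\<psi>(1)[OF s_dom[OF e_r[OF that(1)]]] by (simp add: p_def)
    then have "norm v \<le> norm v / 2" using e_near[OF that(1)] by simp
    then show ?thesis by simp
  qed
  have cont_e: "continuous_on (ball 0 \<rho>) e"
  proof (rule lipschitz_on_continuous_on)
    show "(max K 0)-lipschitz_on (ball 0 \<rho>) e"
    proof (rule lipschitz_onI)
      fix v w :: 'e assume "v \<in> ball 0 \<rho>" "w \<in> ball 0 \<rho>"
      then have "dist (e v) (e w) \<le> K * dist v w" using e_lip[of v w] by (simp add: dist_norm)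
      also have "\<dots> \<le> max K 0 * dist v w" by (intro mult_right_mono) auto
      finally show "dist (e v) (e w) \<le> max K 0 * dist v w" .
    qed auto
  qed
  have cont_f: "continuous_on (ball 0 \<rho>) f"
    unfolding f_def s_def
    by (rule continuous_on_compose2[OF cont']) (use e_r s_dom in \<open>auto intro!: continuous_intros cont_e\<close>)
  \<comment> \<open>On the half ball the difference v - w still lies where \<open>f_add\<close> and
    \<open>f_ker\<close> apply.\<close>
  have inj_e: "inj_on e (ball 0 (\<rho> / 2))"
  proof (rule inj_onI)
    fix v w :: 'e assume vw: "v \<in> ball 0 (\<rho> / 2)" "w \<in> ball 0 (\<rho> / 2)" "e v = e w"
    have n: "norm (v - w) < \<rho>" "norm w < \<rho>" "norm v < \<rho>"
      using vw norm_triangle_ineq4[of v w] \<rho> by auto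
    have "f w + f (v - w) = f v" using f_add[of w "v - w"] n by simp
    then have "f (v - w) = 0" using vw by (simp add: f_def)
    then show "v = w" using f_ker[OF n(1)] by simp
  qed
  show ?thesis
  proof
    show "\<rho> / 2 > 0" using \<rho> by simp
    show "continuous_on (ball 0 (\<rho> / 2)) f"
      by (rule continuous_on_subset[OF cont_f]) (use \<rho> in auto)
    show "f (v + w) = f v + f w" if "norm v < \<rho> / 2" "norm w < \<rho> / 2" "norm (v + w) < \<rho> / 2" for v w
      by (rule f_add) (use that \<rho> in linarith)+
    fix S :: "'e set" assume S: "open S" "S \<subseteq> ball 0 (\<rho> / 2)"
    have S': "S \<subseteq> ball 0 \<rho>" using S \<rho> by force
    have "open (e ` S)"
      by (rule invariance_of_domain)
        (use S S' continuous_on_subset[OF cont_e] inj_on_subset[OF inj_e] in auto)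
    then have "open ((+) p ` e ` S)" by (rule open_translation)
    then have op: "open (U \<inter> \<phi> -` ((+) p ` e ` S))"
      using continuous_open_preimage[OF cont U] by blast
    have "f ` S = U \<inter> \<phi> -` ((+) p ` e ` S)"
    proof (intro equalityI subsetI)
      fix x assume "x \<in> f ` S"
      then obtain v where v: "v \<in> S" "x = f v" by blast
      then have "p + e v \<in> \<phi> ` U" using S' e_r s_dom by force
      then show "x \<in> U \<inter> \<phi> -` ((+) p ` e ` S)"
        using v by (auto simp: f_def s_def \<phi>\<psi>)
    next
      fix x assume "x \<in> U \<inter> \<phi> -` ((+) p ` e ` S)"
      then obtain v where "x \<in> U" "\<phi> x = p + e v" "v \<in> S" by auto
      then show "x \<in> f ` S" using \<psi>\<phi>[of x] by (auto simp: f_def s_def intro!: image_eqI[of _ _ v])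
    qed
    then show "open (f ` S)" using op by simp
  qed
qed

subsection \<open>The exponential covering\<close>

lemma open_translation_add:
  fixes S :: "'g::topological_ab_group_add set"
  assumes "open S"
  shows "open ((+) a ` S)"
proof -
  have "(+) a ` S = (\<lambda>x. - a + x) -` S"
    by (auto simp: image_iff intro!: bexI[of _ "- a + _"])
  moreover have "open ((\<lambda>x. - a + x) -` S)"
    using assms by (intro open_vimage) (auto intro!: continuous_intros)
  ultimately show ?thesis by simp
qed

text \<open>A vector is scaled into the small ball by halving n times, \<open>f\<close> is applied,
  and the result is doubled n times in the group. Additivity of \<open>f\<close> on halves makes the
  value independent of n, so one common n can serve v, w and v + w.\<close>

lemma local_hom_extends:
  fixes f :: "'a::real_normed_vector \<Rightarrow> 'g::ab_group_add"
  assumes \<rho>: "\<rho> > 0"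
    and f_add: "\<And>v w. \<lbrakk>norm v < \<rho>; norm w < \<rho>; norm (v + w) < \<rho>\<rbrakk> \<Longrightarrow> f (v + w) = f v + f w"
  obtains E where "\<And>v w. E (v + w) = E v + E w" "\<And>v. norm v < \<rho> \<Longrightarrow> E v = f v"
proof -
  define dbl :: "'g \<Rightarrow> 'g" where "dbl x = x + x" for x
  have dbl_add: "(dbl ^^ n) (x + y) = (dbl ^^ n) x + (dbl ^^ n) y" for n x y
    by (induction n) (simp_all add: dbl_def algebra_simps)
  define s :: "nat \<Rightarrow> 'a \<Rightarrow> 'a" where "s n v = v /\<^sub>R 2 ^ n" for n v
  have s_norm: "norm (s n v) = norm v / 2 ^ n" for n v
    by (simp add: s_def divide_inverse_commute)
  have s_mono: "norm (s m v) < \<rho>" if "norm (s n v) < \<rho>" "n \<le> m" for n m v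
  proof -
    have "norm v / 2 ^ m \<le> norm v / 2 ^ n"
      using that(2) by (intro divide_left_mono power_increasing) auto
    then show ?thesis using that(1) by (simp add: s_norm)
  qed
  have ex: "\<exists>n. norm (s n v) < \<rho>" for v
  proof -
    obtain n where "norm v / \<rho> < 2 ^ n" using real_arch_pow[of 2 "norm v / \<rho>"] by auto
    then have "norm (s n v) < \<rho>" using \<rho> by (simp add: s_norm field_simps)
    then show ?thesis ..
  qed
  define E where "E v = (let n = (LEAST n. norm (s n v) < \<rho>) in (dbl ^^ n) (f (s n v)))" for v
  have step: "f (s n v) = dbl (f (s (Suc n) v))" if "norm (s n v) < \<rho>" for n v
  proof -
    have eq: "s n v = s (Suc n) v + s (Suc n) v"
      by (simp add: s_def flip: scaleR_add_left)
    have "norm (s (Suc n) v) < \<rho>" using s_mono[OF that, of "Suc n"] by simp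
    then show ?thesis using f_add[of "s (Suc n) v" "s (Suc n) v"] that by (simp add: eq dbl_def)
  qed
  have steps: "(dbl ^^ n) (f (s n v)) = (dbl ^^ (n + k)) (f (s (n + k) v))" if "norm (s n v) < \<rho>" for n k v
  proof (induction k)
    case (Suc k)
    have "norm (s (n + k) v) < \<rho>" using s_mono[OF that] by simp
    then show ?case using Suc step by (simp add: funpow_swap1)
  qed simp
  have E: "E v = (dbl ^^ m) (f (s m v))" if "norm (s m v) < \<rho>" for m v
  proof -
    define n where "n = (LEAST n. norm (s n v) < \<rho>)"
    have n: "norm (s n v) < \<rho>" "n \<le> m"
      unfolding n_def using that by (auto intro: LeastI Least_le)
    then show ?thesis
      using steps[OF n(1), of "m - n"] by (simp add: E_def n_def[symmetric])
  qed
  show ?thesis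
  proof
    show "E v = f v" if "norm v < \<rho>" for v
      using E[of 0 v] that by (simp add: s_def)
    fix v w
    obtain i j k where "norm (s i v) < \<rho>" "norm (s j w) < \<rho>" "norm (s k (v + w)) < \<rho>"
      using ex by blast
    then have m: "norm (s (i + j + k) v) < \<rho>" "norm (s (i + j + k) w) < \<rho>" "norm (s (i + j + k) (v + w)) < \<rho>"
      by (auto elim!: s_mono)
    have "s (i + j + k) (v + w) = s (i + j + k) v + s (i + j + k) w"
      by (simp add: s_def scaleR_add_right)
    then show "E (v + w) = E v + E w"
      using m f_add[of "s (i + j + k) v" "s (i + j + k) w"] E[OF m(1)] E[OF m(2)] E[OF m(3)]
      by (simp add: dbl_add)
  qed
qed

text \<open>This models the exponential map of a connected abelian Lie group, through its properties
  as an open continuous homomorphism of a vector space onto the group.\<close>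

locale vector_cover =
  fixes E :: "'e::euclidean_space \<Rightarrow> 'g::{topological_ab_group_add,t2_space}"
  assumes add: "E (v + w) = E v + E w"
    and cont: "continuous_on UNIV E"
    and surj: "surj E"
    and open_map: "open S \<Longrightarrow> open (E ` S)"

text \<open>The additive extension of the local map is continuous and open everywhere, since near
  each point it is a translate of the local map. Its range is an open subgroup, hence also closed,
  and connectedness makes it everything.\<close>

lemma lie_group_atlas_vector_cover:
  fixes A :: "('g::{topological_ab_group_add,t2_space} set \<times> ('g \<Rightarrow> 'e::euclidean_space)) set"
  assumes A: "lie_group_atlas A" and conn: "connected (UNIV :: 'g set)"
  obtains E :: "'e \<Rightarrow> 'g" where "vector_cover E"
proof -
  obtain \<rho> and f :: "'e \<Rightarrow> 'g" where \<rho>: "\<rho> > 0" and cont_f: "continuous_on (ball 0 \<rho>) f"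
    and open_f: "\<And>S. \<lbrakk>open S; S \<subseteq> ball 0 \<rho>\<rbrakk> \<Longrightarrow> open (f ` S)"
    and f_add: "\<And>v w. \<lbrakk>norm v < \<rho>; norm w < \<rho>; norm (v + w) < \<rho>\<rbrakk> \<Longrightarrow> f (v + w) = f v + f w"
    using lie_group_atlas_local_exponential[OF A] by metis
  obtain E where E_add: "\<And>v w. E (v + w) = E v + E w" and E_f: "\<And>v. norm v < \<rho> \<Longrightarrow> E v = f v"
    using local_hom_extends[OF \<rho> f_add] by metis
  have E_at: "E v = E a + f (v - a)" if "v \<in> ball a \<rho>" for a v
    using E_add[of a "v - a"] E_f[of "v - a"] that by (simp add: dist_norm norm_minus_commute)
  have "continuous_on UNIV E"
  proof -
    have "isCont E a" for a
    proof -
      have "continuous_on (ball a \<rho>) (\<lambda>v. E a + f (v - a))"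
        by (intro continuous_intros continuous_on_compose2[OF cont_f]) (auto simp: dist_norm norm_minus_commute)
      then have "continuous_on (ball a \<rho>) E"
        by (rule continuous_on_eq) (simp add: E_at)
      then show ?thesis
        using \<rho> by (simp add: continuous_on_eq_continuous_at)
    qed
    then show ?thesis by (simp add: continuous_on_eq_continuous_at)
  qed
  have E_open: "open (E ` S)" if S: "open S" for S
  proof (subst open_subopen, intro ballI)
    fix x assume "x \<in> E ` S"
    then obtain a where a: "a \<in> S" "x = E a" by blast
    obtain \<epsilon>' where "\<epsilon>' > 0" "ball a \<epsilon>' \<subseteq> S" using S a open_contains_ball by blast
    define \<epsilon> where "\<epsilon> = min \<epsilon>' \<rho>"
    have \<epsilon>: "\<epsilon> > 0" "ball a \<epsilon> \<subseteq> S" "\<epsilon> \<le> \<rho>"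
      using \<rho> \<open>\<epsilon>' > 0\<close> \<open>ball a \<epsilon>' \<subseteq> S\<close> by (auto simp: \<epsilon>_def)
    have "open ((+) (E a) ` f ` ball 0 \<epsilon>)"
      using \<epsilon> by (intro open_translation_add open_f) auto
    moreover have "x \<in> (+) (E a) ` f ` ball 0 \<epsilon>"
    proof -
      have "f 0 = 0" using E_at[of a a] \<rho> by simp
      then show ?thesis using a \<epsilon> by (intro image_eqI[of _ _ "f 0"] imageI) auto
    qed
    moreover have "(+) (E a) ` f ` ball 0 \<epsilon> \<subseteq> E ` S"
    proof safe
      fix v :: 'e assume v: "v \<in> ball 0 \<epsilon>"
      then have "E a + f v = E (a + v)" using E_at[of "a + v" a] \<epsilon> by (simp add: dist_norm)
      moreover have "a + v \<in> S" using v \<epsilon> by (auto simp: dist_norm)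
      ultimately show "E a + f v \<in> E ` S" by simp
    qed
    ultimately show "\<exists>T. open T \<and> x \<in> T \<and> T \<subseteq> E ` S" by blast
  qed
  have E_0: "E 0 = 0" using E_add[of 0 0] by simp
  have E_minus: "E (- v) = - E v" for v
    using E_add[of v "- v"] E_0 by (metis add.right_inverse minus_unique)
  have "surj E"
  proof -
    \<comment> \<open>The union of all cosets of the range other than the range itself; it is open
      and turns out to be the complement of the range.\<close>
    define C where "C = (\<Union>x\<in>- range E. (+) x ` range E)"
    have "open C" unfolding C_def by (intro open_UN ballI open_translation_add E_open) auto
    moreover have "C = - range E"
    proof safe
      fix v assume "E v \<in> C"
      then obtain x w where x: "x \<notin> range E" "E v = x + E w" by (auto simp: C_def)
      then have "x = E (v - w)"
        using E_add[of v "- w"] by (simp add: E_minus)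
      then show False using x by blast
    next
      fix x assume "x \<notin> range E"
      then show "x \<in> C" unfolding C_def using E_0
        by (intro UN_I[of x] image_eqI[of _ _ 0]) (auto intro: rangeI[of E 0, unfolded E_0])
    qed
    ultimately have "open (- range E)" by simp
    moreover have "open (range E)" by (rule E_open) simp
    ultimately show ?thesis
      using connectedD[OF conn, of "range E" "- range E"] by auto
  qed
  then show ?thesis
    using that[of E] E_add E_open \<open>continuous_on UNIV E\<close> by (simp add: vector_cover_def)
qed

subsection \<open>Dimension of the quotient\<close>

text \<open>If n < m, the target sits inside the m-dimensional space as a coordinate subspace. By
  invariance of domain the image would be open in the larger space, although its coordinate with
  index n vanishes.\<close>

lemma dim_le_if_open_injects_Euclidean_space:
  assumes W: "openin (Euclidean_space m) W" "W \<noteq> {}"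
    and f: "continuous_map (subtopology (Euclidean_space m) W) (Euclidean_space n) f" "inj_on f W"
  shows "m \<le> n"
proof (rule ccontr)
  assume "\<not> m \<le> n"
  then have nm: "n < m" by simp
  have sub: "Euclidean_space n = subtopology (Euclidean_space m) (topspace (Euclidean_space n))"
    using nm by (metis Euclidean_space_def inf.absorb_iff2 less_imp_le subset_Euclidean_space
        subtopology_subtopology topspace_Euclidean_space)
  have "continuous_map (subtopology (Euclidean_space m) W) (Euclidean_space m) f"
    using f(1) by (subst (asm) sub) (simp add: continuous_map_in_subtopology)
  then have op: "openin (Euclidean_space m) (f ` W)"
    using W f by (intro invariance_of_domain_Euclidean_space)
  have Wt: "W \<subseteq> topspace (Euclidean_space m)"
    using W by (simp add: openin_subset)
  have fW: "f ` W \<subseteq> topspace (Euclidean_space n)"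
    using continuous_map_image_subset_topspace[OF f(1)] Wt by (simp add: Int_absorb1)
  obtain y where y: "y \<in> f ` W" using W by blast
  \<comment> \<open>The line through \<open>y\<close> in direction n meets the image only at t = 0,
    so the preimage of the open image would be an open singleton.\<close>
  define h where "h t = (\<lambda>i. if i < m then (if i = n then t else y i) else 0)" for t :: real
  have "continuous_map euclideanreal (Euclidean_space m) h"
    unfolding h_def continuous_map_componentwise_Euclidean_space
    by (auto intro!: continuous_intros split: if_splits)
  then have "openin euclideanreal {t \<in> topspace euclideanreal. h t \<in> f ` W}"
    using op by (rule openin_continuous_map_preimage)
  moreover have "{t \<in> topspace euclideanreal. h t \<in> f ` W} = {0}"
  proof -
    have "h 0 = y"
    proof
      fix i
      show "h 0 i = y i"
        using y fW nm by (auto simp: h_def topspace_Euclidean_space)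
    qed
    moreover have "t = 0" if "h t \<in> f ` W" for t
    proof -
      have "h t n = 0" using that fW by (auto simp: topspace_Euclidean_space)
      then show ?thesis using nm by (simp add: h_def)
    qed
    ultimately show ?thesis using y by auto
  qed
  ultimately show False by (simp add: not_open_singleton)
qed

text \<open>A chart at a single point relates nonempty open sets of the two Euclidean spaces, and
  the preceding inequality is used in both directions. Nonemptiness supplies the point; the empty
  space is locally Euclidean of every dimension.\<close>

lemma locally_euclidean_dim_unique:
  assumes X: "X homeomorphic_space Euclidean_space m" "topspace X \<noteq> {}"
    and d: "locally_euclidean_dim X d"
  shows "d = m"
proof -
  obtain p where p: "p \<in> topspace X" using X by blast
  then obtain U V where U: "openin X U" "p \<in> U" and V: "openin (Euclidean_space d) V"
    and UV: "subtopology X U homeomorphic_space subtopology (Euclidean_space d) V"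
    using d unfolding locally_euclidean_dim_def by blast
  obtain h where h: "homeomorphic_map X (Euclidean_space m) h"
    using X by (auto simp: homeomorphic_space)
  have Ut: "U \<subseteq> topspace X" using U by (simp add: openin_subset)
  define W where "W = h ` U"
  have W: "openin (Euclidean_space m) W" "W \<noteq> {}"
    using h U Ut homeomorphic_map_openness by (fastforce simp: W_def)+
  have "homeomorphic_map (subtopology X U) (subtopology (Euclidean_space m) W) h"
    using h by (rule homeomorphic_map_subtopologies) (use Ut W openin_subset in \<open>fastforce simp: W_def\<close>)
  then have "subtopology X U homeomorphic_space subtopology (Euclidean_space m) W"
    by (auto simp: homeomorphic_space)
  then have WV: "subtopology (Euclidean_space m) W homeomorphic_space subtopology (Euclidean_space d) V"
    using UV homeomorphic_space_sym homeomorphic_space_trans by blast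
  have inject: "m' \<le> d'" if A: "openin (Euclidean_space m') A" "A \<noteq> {}"
    and AB: "subtopology (Euclidean_space m') A homeomorphic_space subtopology (Euclidean_space d') B" for m' d' A B
  proof -
    obtain f where f: "homeomorphic_map (subtopology (Euclidean_space m') A) (subtopology (Euclidean_space d') B) f"
      using AB by (auto simp: homeomorphic_space)
    show ?thesis
    proof (rule dim_le_if_open_injects_Euclidean_space[OF A])
      show "continuous_map (subtopology (Euclidean_space m') A) (Euclidean_space d') f"
        using homeomorphic_imp_continuous_map[OF f] by (simp add: continuous_map_in_subtopology)
      show "inj_on f A"
        using homeomorphic_imp_injective_map[OF f] openin_subset[OF A(1)] by (simp add: Int_absorb1)
    qed
  qed
  have "V \<noteq> {}"
  proof
    assume "V = {}"
    then have "topspace (subtopology (Euclidean_space m) W) = {}"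
      using WV homeomorphic_empty_space_eq[of "subtopology (Euclidean_space d) V"]
      by (metis homeomorphic_empty_space null_topspace_iff_trivial inf_bot_right topspace_subtopology)
    then show False using W openin_subset by fastforce
  qed
  then show ?thesis
    using inject[OF W WV] inject[OF V _ homeomorphic_space_sym[THEN iffD1, OF WV]] by simp
qed

lemma orthogonal_projection_exists:
  fixes V :: "'a::euclidean_space set"
  assumes V: "subspace V"
  obtains Q where "linear Q" "\<And>v. Q v \<in> V" "\<And>v w. w \<in> V \<Longrightarrow> (v - Q v) \<bullet> w = 0"
proof -
  obtain B where B: "B \<subseteq> V" "pairwise orthogonal B" "\<And>x. x \<in> B \<Longrightarrow> norm x = 1"
    "independent B" "span B = V"
    using orthonormal_basis_subspace[OF V] by metis
  have fin: "finite B" using B(4) independent_imp_finite by blast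
  define Q where "Q v = (\<Sum>b\<in>B. (v \<bullet> b) *\<^sub>R b)" for v
  show ?thesis
  proof
    show "linear Q"
      unfolding Q_def[abs_def]
      by (intro linearI) (simp_all add: inner_add_left scaleR_add_left sum.distrib scaleR_sum_right)
    show "Q v \<in> V" for v
      unfolding Q_def using B V by (intro subspace_sum) (auto intro: subspace_scale)
    fix v w assume "w \<in> V"
    have "orthogonal (v - Q v) w"
    proof (rule orthogonal_to_span)
      show "w \<in> span B" using \<open>w \<in> V\<close> B by simp
      fix b assume b: "b \<in> B"
      have "Q v \<bullet> b = (\<Sum>c\<in>B. if c = b then v \<bullet> b else 0)"
        unfolding Q_def inner_sum_left
      proof (rule sum.cong)
        fix c assume c: "c \<in> B"
        show "((v \<bullet> c) *\<^sub>R c) \<bullet> b = (if c = b then v \<bullet> b else 0)"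
          using B(2,3) b c by (auto simp: pairwise_def orthogonal_def norm_eq_1)
      qed simp
      then show "orthogonal (v - Q v) b"
        using fin b by (simp add: orthogonal_def inner_diff_left)
    qed
    then show "(v - Q v) \<bullet> w = 0" by (simp add: orthogonal_def)
  qed
qed

section \<open>Cosets and the quotient topology\<close>

lemma mem_translation_iff: "y \<in> (+) x ` T \<longleftrightarrow> y - x \<in> T" for x y :: "'g::ab_group_add"
  by (auto simp: image_iff intro!: bexI[of _ "y - x"])

lemma is_subgroup_coset_eq_iff:
  assumes T: "is_subgroup T"
  shows "(+) x ` T = (+) y ` T \<longleftrightarrow> y - x \<in> T"
proof
  assume "(+) x ` T = (+) y ` T"
  moreover have "y \<in> (+) y ` T" using T by (simp add: mem_translation_iff is_subgroup_def)
  ultimately show "y - x \<in> T" using mem_translation_iff by metis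
next
  assume yx: "y - x \<in> T"
  have "z - x \<in> T \<longleftrightarrow> z - y \<in> T" for z
  proof
    assume "z - x \<in> T"
    then have "(z - x) + - (y - x) \<in> T" using T yx unfolding is_subgroup_def by blast
    then show "z - y \<in> T" by simp
  next
    assume "z - y \<in> T"
    then have "(z - y) + (y - x) \<in> T" using T yx unfolding is_subgroup_def by blast
    then show "z - x \<in> T" by simp
  qed
  then show "(+) x ` T = (+) y ` T"
    using mem_translation_iff by blast
qed

text \<open>Distinct cosets are disjoint, so the union of a set of cosets is its preimage under the
  projection to the quotient.\<close>

lemma mem_Union_cosets_iff:
  assumes T: "is_subgroup T" and U: "U \<subseteq> range (\<lambda>x. (+) x ` T)"
  shows "x \<in> \<Union>U \<longleftrightarrow> (+) x ` T \<in> U"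
proof
  assume "x \<in> \<Union>U"
  then obtain y where y: "(+) y ` T \<in> U" "x \<in> (+) y ` T" using U by blast
  then have "(+) y ` T = (+) x ` T"
    using T by (simp add: is_subgroup_coset_eq_iff mem_translation_iff)
  then show "(+) x ` T \<in> U" using y by simp
next
  assume "(+) x ` T \<in> U"
  moreover have "x \<in> (+) x ` T" using T by (simp add: mem_translation_iff is_subgroup_def)
  ultimately show "x \<in> \<Union>U" by blast
qed

text \<open>The defining predicate can be read back from \<open>topology\<close> once it is known to
  be a topology. The point to check is intersections, where disjointness of cosets lets union
  commute with intersection.\<close>

lemma openin_quotient_top:
  assumes T: "is_subgroup T"
  shows "openin (quotient_top T) U \<longleftrightarrow> U \<subseteq> range (\<lambda>x. (+) x ` T) \<and> open (\<Union>U)"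
proof -
  have "istopology (\<lambda>U. U \<subseteq> range (\<lambda>x. (+) x ` T) \<and> open (\<Union>U))"
    unfolding istopology_def
  proof (intro conjI allI impI)
    fix S S' assume S: "S \<subseteq> range (\<lambda>x. (+) x ` T) \<and> open (\<Union>S)" and S': "S' \<subseteq> range (\<lambda>x. (+) x ` T) \<and> open (\<Union>S')"
    have "x \<in> \<Union>(S \<inter> S') \<longleftrightarrow> x \<in> \<Union>S \<inter> \<Union>S'" for x
      using mem_Union_cosets_iff[OF T, of S x] mem_Union_cosets_iff[OF T, of S' x]
        mem_Union_cosets_iff[OF T, of "S \<inter> S'" x] S S' by blast
    then have "\<Union>(S \<inter> S') = \<Union>S \<inter> \<Union>S'" by blast
    then show "open (\<Union>(S \<inter> S'))" using S S' by auto
    show "S \<inter> S' \<subseteq> range (\<lambda>x. (+) x ` T)" using S by blast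
  next
    fix \<K> assume \<K>: "\<forall>K\<in>\<K>. K \<subseteq> range (\<lambda>x. (+) x ` T) \<and> open (\<Union>K)"
    have "\<Union>(\<Union>\<K>) = (\<Union>K\<in>\<K>. \<Union>K)" by blast
    then show "open (\<Union>(\<Union>\<K>))" using \<K> by auto
    show "\<Union>\<K> \<subseteq> range (\<lambda>x. (+) x ` T)" using \<K> by blast
  qed
  then show ?thesis by (simp add: quotient_top_def topology_inverse')
qed

lemma topspace_quotient_top:
  assumes T: "is_subgroup T"
  shows "topspace (quotient_top T) = range (\<lambda>x. (+) x ` T)"
proof
  show "topspace (quotient_top T) \<subseteq> range (\<lambda>x. (+) x ` T)"
    using openin_topspace[of "quotient_top T"] openin_quotient_top[OF T] by blast
  have "\<Union>(range (\<lambda>x. (+) x ` T)) = UNIV"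
    using mem_Union_cosets_iff[OF T order_refl] by blast
  then have "openin (quotient_top T) (range (\<lambda>x. (+) x ` T))"
    unfolding openin_quotient_top[OF T] by simp
  then show "range (\<lambda>x. (+) x ` T) \<subseteq> topspace (quotient_top T)"
    by (rule openin_subset)
qed

subsection \<open>Kernel, maximal compact subgroup and lower bound\<close>

context vector_cover
begin

lemma zero: "E 0 = 0"
  using add[of 0 0] by simp

lemma minus: "E (- v) = - E v"
  using add[of v "- v"] zero by (metis add.right_inverse minus_unique)

lemma diff: "E (v - w) = E v - E w"
  using add[of v "- w"] by (simp add: minus)

lemma sum: "E (\<Sum>i\<in>I. f i) = (\<Sum>i\<in>I. E (f i))"
  by (induction I rule: infinite_finite_induct) (simp_all add: zero add)

text \<open>The kernel of the exponential map. As a set of vectors it has as its \<open>dim\<close>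
  the dimension of its linear span.\<close>

definition periods :: "'e set" where
  "periods = {v. E v = 0}"

lemma nat_multiple_mem_subgroup:
  assumes "is_subgroup H" "E v \<in> H"
  shows "E (real n *\<^sub>R v) \<in> H"
proof (induction n)
  case 0
  then show ?case using assms by (simp add: zero is_subgroup_def)
next
  case (Suc n)
  then show ?case using assms unfolding of_nat_Suc scaleR_add_left add is_subgroup_def by simp
qed

lemma int_multiple_periods:
  assumes "v \<in> periods"
  shows "of_int k *\<^sub>R v \<in> periods"
proof -
  have nat: "real n *\<^sub>R v \<in> periods" for n
    using nat_multiple_mem_subgroup[of "{0}" v n] assms by (simp add: periods_def is_subgroup_def)
  show ?thesis
  proof (cases "k \<ge> 0")
    case True
    then show ?thesis using nat[of "nat k"] by simp
  next
    case False
    then have "of_int k *\<^sub>R v = - (real (nat (- k)) *\<^sub>R v)" by simp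
    then show ?thesis using nat[of "nat (- k)"] by (simp add: periods_def minus)
  qed
qed

text \<open>Two preimages of a point differ by a period, so the functional is constant on the fibres
  of \<open>E\<close>. The induced function is continuous because \<open>E\<close> is open and
  onto.\<close>

lemma functional_descends:
  assumes "\<And>v. v \<in> periods \<Longrightarrow> u \<bullet> v = 0"
  obtains L :: "'g \<Rightarrow> real" where "continuous_on UNIV L" "\<And>v. L (E v) = u \<bullet> v"
proof
  define L where "L x = u \<bullet> inv_into UNIV E x" for x
  show L: "L (E v) = u \<bullet> v" for v
  proof -
    have "inv_into UNIV E (E v) - v \<in> periods"
      using surj by (simp add: periods_def diff surj_f_inv_f)
    then have "u \<bullet> (inv_into UNIV E (E v) - v) = 0" by (rule assms)
    then show ?thesis by (simp add: L_def inner_diff_right)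
  qed
  show "continuous_on UNIV L"
  proof (subst continuous_on_open_vimage, simp, intro allI impI)
    fix S :: "real set" assume "open S"
    then have "open ((\<lambda>v. u \<bullet> v) -` S)"
      by (intro open_vimage) (auto intro!: continuous_intros)
    moreover have "L -` S \<inter> UNIV = E ` ((\<lambda>v. u \<bullet> v) -` S)"
    proof (intro equalityI subsetI)
      fix x assume x: "x \<in> L -` S \<inter> UNIV"
      have "E (inv_into UNIV E x) = x" using surj by (rule surj_f_inv_f)
      moreover from this have "u \<bullet> inv_into UNIV E x \<in> S" using x L[of "inv_into UNIV E x"] by simp
      ultimately show "x \<in> E ` ((\<lambda>v. u \<bullet> v) -` S)" by (metis imageI vimageI)
    qed (auto simp: L)
    ultimately show "open (L -` S \<inter> UNIV)" using open_map by simp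
  qed
qed

lemma is_subgroup_image_span_periods: "is_subgroup (E ` span periods)"
  unfolding is_subgroup_def
proof (intro conjI ballI)
  show "0 \<in> E ` span periods" using zero span_zero by (metis imageI)
next
  fix x y assume "x \<in> E ` span periods" "y \<in> E ` span periods"
  then show "x + y \<in> E ` span periods" by (auto simp: add[symmetric] intro!: imageI span_add)
next
  fix x assume "x \<in> E ` span periods"
  then show "- x \<in> E ` span periods" by (auto simp: minus[symmetric] intro!: imageI span_neg)
qed

lemma compact_image_span_periods: "compact (E ` span periods)"
proof -
  obtain B where B: "B \<subseteq> periods" "independent B" "periods \<subseteq> span B"
    using maximal_independent_subset by blast
  have fin: "finite B" using B(2) independent_imp_finite by blast
  have span: "span B = span periods" using B by (simp add: span_eq span_superset order_trans[OF _ span_superset])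
  define R where "R = (\<Sum>b\<in>B. norm b)"
  have "E ` span periods = E ` (span periods \<inter> cball 0 R)"
  proof (intro equalityI subsetI)
    fix x assume "x \<in> E ` span periods"
    then obtain v where v: "x = E v" "v \<in> span B" using span by auto
    then obtain c where c: "v = (\<Sum>b\<in>B. c b *\<^sub>R b)" using fin by (auto simp: span_finite)
    define w where "w = (\<Sum>b\<in>B. frac (c b) *\<^sub>R b)"
    define k where "k = (\<Sum>b\<in>B. of_int \<lfloor>c b\<rfloor> *\<^sub>R b)"
    have "v = w + k"
      by (simp add: c w_def k_def frac_def flip: sum.distrib scaleR_add_left)
    moreover have "E k = 0"
      unfolding k_def sum using B(1) int_multiple_periods by (intro sum.neutral) (auto simp: periods_def)
    ultimately have "x = E w" using v by (simp add: add)
    moreover have "w \<in> span periods"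
      unfolding w_def using B(1) by (intro span_sum span_scale span_base) auto
    moreover have "norm w \<le> R"
      unfolding w_def R_def
    proof (rule sum_norm_le)
      fix b
      have "\<bar>frac (c b)\<bar> \<le> 1" using frac_lt_1[of "c b"] frac_ge_0[of "c b"] by simp
      then show "norm (frac (c b) *\<^sub>R b) \<le> norm b" by (simp add: mult_left_le_one_le)
    qed
    ultimately show "x \<in> E ` (span periods \<inter> cball 0 R)" by auto
  qed auto
  moreover have "compact (span periods \<inter> cball 0 R)"
    by (intro closed_Int_compact closed_span compact_cball)
  ultimately show ?thesis
    using compact_continuous_image[OF continuous_on_subset[OF cont]] by (metis subset_UNIV)
qed

text \<open>Let \<open>z\<close> be the component of a lift of \<open>x\<close> orthogonal to the
  span of the periods. The functional given by \<open>z\<close> descends to a continuous function,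
  which is bounded on \<open>H\<close> but takes the value n |z|^2 at the n-th multiple of
  \<open>x\<close>; so z = 0.\<close>

lemma compact_subgroup_subset:
  assumes H: "is_subgroup H" "compact H"
  shows "H \<subseteq> E ` span periods"
proof
  fix x assume x: "x \<in> H"
  obtain v where v: "x = E v" using surj by blast
  obtain Q where Q: "\<And>v. Q v \<in> span periods" "\<And>v w. w \<in> span periods \<Longrightarrow> (v - Q v) \<bullet> w = 0"
    using orthogonal_projection_exists[OF subspace_span] by metis
  define z where "z = v - Q v"
  have z: "z \<bullet> w = 0" if "w \<in> span periods" for w using Q(2) that by (simp add: z_def)
  obtain L :: "'g \<Rightarrow> real" where L: "continuous_on UNIV L" "\<And>v. L (E v) = z \<bullet> v"
    using functional_descends[of z] z span_base by blast
  have "z \<bullet> v = z \<bullet> (Q v + z)" by (simp add: z_def)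
  then have zv: "z \<bullet> v = z \<bullet> z" using z[OF Q(1)[of v]] by (simp add: inner_add_right)
  have "bounded (L ` H)"
    using compact_continuous_image[OF continuous_on_subset[OF L(1)] H(2)] compact_imp_bounded by blast
  then obtain b where b: "\<And>y. y \<in> H \<Longrightarrow> \<bar>L y\<bar> \<le> b" by (auto simp: bounded_iff)
  have bound: "real n * (z \<bullet> z) \<le> b" for n
    using b[OF nat_multiple_mem_subgroup[OF H(1), of v n]] x v zv by (simp add: L(2))
  have "z \<bullet> z = 0"
  proof (rule ccontr)
    assume "z \<bullet> z \<noteq> 0"
    then have "z \<bullet> z > 0" by (simp add: inner_gt_zero_iff)
    then obtain n where "b < real n * (z \<bullet> z)" using reals_Archimedean3 by blast
    then show False using bound[of n] by linarith
  qed
  then have "v = Q v" by (simp add: z_def)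
  then show "x \<in> E ` span periods" using v Q(1) by (metis imageI)
qed

lemma maximal_compact_subgroup_eq:
  assumes "maximal_compact_subgroup T"
  shows "T = E ` span periods"
  using assms compact_subgroup_subset is_subgroup_image_span_periods compact_image_span_periods
  unfolding maximal_compact_subgroup_def by metis

lemma quotient_homeomorphic_orthogonal_complement:
  defines "V \<equiv> span periods" and "W \<equiv> {w. \<forall>v\<in>span periods. orthogonal v w}"
  shows "top_of_set W homeomorphic_space quotient_top (E ` V)"
proof -
  obtain Q where Q: "linear Q" "\<And>v. Q v \<in> V" "\<And>v w. w \<in> V \<Longrightarrow> (v - Q v) \<bullet> w = 0"
    unfolding V_def using orthogonal_projection_exists[OF subspace_span] by metis
  have T: "is_subgroup (E ` V)" unfolding V_def by (rule is_subgroup_image_span_periods)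
  define q where "q u = (+) (E u) ` E ` V" for u
  have q_eq: "q u = q u' \<longleftrightarrow> u' - u \<in> V" for u u'
  proof
    assume "q u = q u'"
    then have "E (u' - u) \<in> E ` V"
      unfolding q_def is_subgroup_coset_eq_iff[OF T] by (simp add: diff)
    then obtain v where v: "v \<in> V" "E (u' - u) = E v" by blast
    then have "u' - u - v \<in> periods" by (simp add: periods_def diff)
    then have "(u' - u - v) + v \<in> V" using v unfolding V_def by (metis span_add span_base)
    then show "u' - u \<in> V" by simp
  next
    assume "u' - u \<in> V"
    then show "q u = q u'"
      unfolding q_def is_subgroup_coset_eq_iff[OF T] by (simp flip: diff)
  qed
  have P: "v - Q v \<in> W" for v
    using Q(3) by (simp add: W_def V_def orthogonal_def inner_commute)
  have qP: "q (v - Q v) = q v" for v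
    unfolding q_eq using Q(2) by simp
  have img: "q ` W = range (\<lambda>x. (+) x ` E ` V)"
  proof (intro equalityI subsetI)
    fix C assume "C \<in> range (\<lambda>x. (+) x ` E ` V)"
    then obtain x where x: "C = (+) x ` E ` V" by blast
    obtain v where "x = E v" using surj by blast
    with x have "C = q v" by (simp add: q_def)
    then show "C \<in> q ` W" using P qP by (metis imageI)
  qed (auto simp: q_def)
  have "homeomorphic_map (top_of_set W) (quotient_top (E ` V)) q"
    unfolding homeomorphic_map_def quotient_map_def
  proof (intro conjI allI impI)
    show "q ` topspace (top_of_set W) = topspace (quotient_top (E ` V))"
      using img by (simp add: topspace_quotient_top[OF T])
    show "inj_on q (topspace (top_of_set W))"
    proof (rule inj_onI)
      fix u u' assume "u \<in> topspace (top_of_set W)" "u' \<in> topspace (top_of_set W)" "q u = q u'"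
      then have "u' - u \<in> V" "(u' - u) \<bullet> (u' - u) = 0"
        using q_eq by (auto simp: W_def V_def orthogonal_def inner_diff_right)
      then show "u = u'" by simp
    qed
  next
    fix U assume "U \<subseteq> topspace (quotient_top (E ` V))"
    then have U: "U \<subseteq> range (\<lambda>x. (+) x ` E ` V)" by (simp add: topspace_quotient_top[OF T])
    have mem: "E v \<in> \<Union>U \<longleftrightarrow> q v \<in> U" for v
      unfolding q_def by (rule mem_Union_cosets_iff[OF T U])
    have "openin (top_of_set W) (W \<inter> E -` \<Union>U) \<longleftrightarrow> open (\<Union>U)"
    proof
      assume "open (\<Union>U)"
      then have "open (E -` \<Union>U)" using cont by (simp add: open_vimage)
      then show "openin (top_of_set W) (W \<inter> E -` \<Union>U)" by auto
    next
      assume "openin (top_of_set W) (W \<inter> E -` \<Union>U)"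
      then obtain O' where O': "open O'" "W \<inter> E -` \<Union>U = W \<inter> O'" by (auto simp: openin_open)
      \<comment> \<open>The preimage of a union of cosets is invariant under \<open>V\<close>, so it
        is recovered from its trace on \<open>W\<close> by projecting; a relatively open trace
        therefore gives an open set in the whole space.\<close>
      have "v \<in> E -` \<Union>U \<longleftrightarrow> v - Q v \<in> O'" for v
      proof -
        have "v \<in> E -` \<Union>U \<longleftrightarrow> v - Q v \<in> E -` \<Union>U"
          by (simp only: vimage_eq mem qP)
        also have "\<dots> \<longleftrightarrow> v - Q v \<in> W \<inter> E -` \<Union>U" using P[of v] by (simp only: Int_iff simp_thms)
        also have "\<dots> \<longleftrightarrow> v - Q v \<in> O'" using P[of v] by (simp only: O'(2) Int_iff simp_thms)
        finally show ?thesis .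
      qed
      then have "E -` \<Union>U = (\<lambda>v. v - Q v) -` O'" by blast
      moreover have "open ((\<lambda>v. v - Q v) -` O')"
        using O'(1) Q(1)
        by (intro open_vimage continuous_on_diff continuous_on_id linear_continuous_on)
          (simp_all add: linear_conv_bounded_linear)
      ultimately have "open (E ` (E -` \<Union>U))" using open_map by simp
      then show "open (\<Union>U)" using surj by (simp add: surj_image_vimage_eq)
    qed
    moreover have "{x \<in> topspace (top_of_set W). q x \<in> U} = W \<inter> E -` \<Union>U"
      by (simp only: set_eq_iff mem_Collect_eq Int_iff vimage_eq mem topspace_euclidean_subtopology simp_thms)
    ultimately show "openin (top_of_set W) {x \<in> topspace (top_of_set W). q x \<in> U} = openin (quotient_top (E ` V)) U"
      using U by (simp add: openin_quotient_top[OF T])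
  qed
  then show ?thesis by (auto simp: homeomorphic_space)
qed

lemma quotient_dimension:
  fixes T :: "'g set"
  assumes T: "maximal_compact_subgroup T" and d: "locally_euclidean_dim (quotient_top T) d"
  shows "d + dim periods = DIM('e)"
proof -
  let ?W = "{w. \<forall>v\<in>span periods. orthogonal v w}"
  have W: "subspace ?W" by (auto simp: subspace_def orthogonal_def inner_add_right)
  have "quotient_top T homeomorphic_space top_of_set ?W"
    using quotient_homeomorphic_orthogonal_complement homeomorphic_space_sym
    unfolding maximal_compact_subgroup_eq[OF T] by blast
  then have "quotient_top T homeomorphic_space Euclidean_space (dim ?W)"
    using homeomorphic_subspace_Euclidean_space_dim[OF W] homeomorphic_space_trans by blast
  moreover have "topspace (quotient_top T) \<noteq> {}"
    using T by (simp add: topspace_quotient_top maximal_compact_subgroup_def)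
  ultimately have "d = dim ?W" using d by (rule locally_euclidean_dim_unique)
  moreover have "dim {y \<in> UNIV. \<forall>x\<in>span periods. orthogonal x y} + dim (span periods) = dim (UNIV :: 'e set)"
    by (rule dim_subspace_orthogonal_to_vectors) auto
  ultimately show ?thesis by simp
qed

text \<open>Otherwise a basis of periods and lifts of all generators but one fail to span, and a
  nonzero functional vanishes on them. It descends to the group and sends the generated subgroup
  into the multiples of one real number, contradicting density. Nontriviality of the group provides
  a generator to omit.\<close>

lemma card_dense_generators_gt:
  fixes A :: "'g set"
  assumes nontrivial: "UNIV \<noteq> {0 :: 'g}" and fin: "finite A" and dense: "closure (subgroup_gen A) = UNIV"
  shows "DIM('e) < card A + dim periods"
proof (rule ccontr)
  assume "\<not> DIM('e) < card A + dim periods"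
  then have le: "card A + dim periods \<le> DIM('e)" by simp
  have "A \<noteq> {}"
  proof
    assume "A = {}"
    have "x = 0" if "x \<in> subgroup_gen A" for x
      using that by induction (use \<open>A = {}\<close> in auto)
    then have "closure (subgroup_gen A) \<subseteq> {0}" by (intro closure_minimal) auto
    then show False using dense nontrivial by auto
  qed
  then obtain a where a: "a \<in> A" by blast
  obtain C where C: "C \<subseteq> periods" "independent C" "periods \<subseteq> span C" "card C = dim periods"
    using basis_exists by blast
  have finC: "finite C" using C(2) independent_imp_finite by blast
  define S where "S = C \<union> inv_into UNIV E ` (A - {a})"
  have finS: "finite S" using finC fin by (simp add: S_def)
  have "dim S \<le> card S" using finS by (rule dim_le_card'[OF _])
  also have "\<dots> \<le> card C + card (inv_into UNIV E ` (A - {a}))" unfolding S_def by (rule card_Un_le)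
  also have "\<dots> \<le> card C + card (A - {a})" using fin by (simp add: card_image_le)
  also have "\<dots> < card C + card A" using card_Diff1_less[OF fin a] by simp
  finally have "dim S < DIM('e)" using le C(4) by simp
  then obtain u where u: "u \<noteq> 0" "\<And>y. y \<in> span S \<Longrightarrow> orthogonal u y"
    using orthogonal_to_subspace_exists[of S] by blast
  have "span C \<subseteq> span S" by (rule span_mono) (simp add: S_def)
  then have "u \<bullet> v = 0" if "v \<in> periods" for v
    using that C(3) u(2) by (auto simp: orthogonal_def)
  then obtain L :: "'g \<Rightarrow> real" where L: "continuous_on UNIV L" "\<And>v. L (E v) = u \<bullet> v"
    using functional_descends by blast
  have L_diff: "L (x - y) = L x - L y" for x y
  proof -
    obtain v w where "x = E v" "y = E w" using surj by (meson surjD)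
    then show ?thesis by (simp add: L(2) inner_diff_right flip: diff)
  qed
  have L_A: "L b = 0" if "b \<in> A" "b \<noteq> a" for b
  proof -
    have "inv_into UNIV E b \<in> span S" using that by (intro span_base) (simp add: S_def)
    then have "L (E (inv_into UNIV E b)) = 0" using u(2) by (simp add: L(2) orthogonal_def)
    then show ?thesis using surj by (simp add: surj_f_inv_f)
  qed
  \<comment> \<open>The integer multiples of \<open>L a\<close>, a closed set even when
    \<open>L a = 0\<close>. Density puts all values of \<open>L\<close>, that is all reals, into it;
    the values 1 and \<open>L a / 2\<close> then give the contradiction.\<close>
  let ?T = "(\<lambda>x. L a *\<^sub>R x) ` range real_of_int"
  have "L x \<in> ?T" if "x \<in> subgroup_gen A" for x
    using that
  proof induction
    case zero
    have "L 0 = 0" using L_diff[of 0 0] by simp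
    then show ?case by (auto intro!: image_eqI[of _ _ 0] image_eqI[of _ _ "0::int"])
  next
    case (gen b)
    show ?case
    proof (cases "b = a")
      case True
      then show ?thesis by (auto intro!: image_eqI[of _ _ 1] image_eqI[of _ _ "1::int"])
    next
      case False
      then show ?thesis using L_A[OF gen] by (auto intro!: image_eqI[of _ _ 0] image_eqI[of _ _ "0::int"])
    qed
  next
    case (diff x y)
    then obtain i j :: int where "L x = L a * of_int i" "L y = L a * of_int j" by auto
    then have "L (x - y) = L a *\<^sub>R of_int (i - j)" by (simp add: L_diff algebra_simps)
    then show ?case by blast
  qed
  then have "L ` subgroup_gen A \<subseteq> ?T" by blast
  moreover have "closed ?T" by (intro closed_scaling closed_of_int_image)
  ultimately have LT: "L x \<in> ?T" for x
    using image_closure_subset[of "subgroup_gen A" L ?T] dense L(1) by auto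
  have "L (E ((t / (u \<bullet> u)) *\<^sub>R u)) = t" for t using u(1) by (simp add: L(2))
  then have T: "t \<in> ?T" for t using LT by metis
  obtain i :: int where "L a / 2 = L a * of_int i" using T[of "L a / 2"] by auto
  moreover have "L a \<noteq> 0" using T[of 1] by auto
  ultimately have "real_of_int (2 * i) = real_of_int 1" by simp
  then have "2 * i = 1" by (simp only: of_int_eq_iff)
  then show False by presburger
qed

end

subsection \<open>Upper bound via Kronecker approximation\<close>

text \<open>A new number must avoid those satisfying an integer relation with the earlier ones and
  1. These are countably many, whereas the unit interval is uncountable.\<close>

lemma ex_int_independent_reals:
  "\<exists>S. finite S \<and> card S = n \<and> 1 \<notin> S \<and> (\<forall>x\<in>S. 0 < x) \<and>
     (\<forall>c::real \<Rightarrow> int. (\<Sum>s\<in>insert 1 S. of_int (c s) * s) = 0 \<longrightarrow> (\<forall>s\<in>insert 1 S. c s = 0))"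
proof (induction n)
  case 0
  show ?case by (intro exI[of _ "{}"]) simp
next
  case (Suc n)
  then obtain S where S: "finite S" "card S = n" "1 \<notin> S" "\<forall>x\<in>S. 0 < x"
    and ind: "\<And>c::real \<Rightarrow> int. (\<Sum>s\<in>insert 1 S. of_int (c s) * s) = 0 \<Longrightarrow> \<forall>s\<in>insert 1 S. c s = 0"
    by blast
  define F where "F = insert 1 S"
  have finF: "finite F" using S by (simp add: F_def)
  \<comment> \<open>Coefficient functions are taken extensional on \<open>F\<close>, which makes the
    family countable.\<close>
  define D where "D = (\<lambda>(k::int, c::real \<Rightarrow> int). - (\<Sum>s\<in>F. of_int (c s) * s) / of_int k) ` (UNIV \<times> (F \<rightarrow>\<^sub>E UNIV))"
  have "countable (F \<rightarrow>\<^sub>E (UNIV :: int set))" using finF by (intro countable_PiE) auto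
  then have "countable D" unfolding D_def by (intro countable_image countable_SIGMA) auto
  then have "countable (D \<union> F)" using finF by (simp add: countable_finite)
  then have "uncountable ({0<..<1} - (D \<union> F))"
    by (intro uncountable_minus_countable) (simp add: uncountable_open_interval)
  then obtain x where x: "0 < x" "x \<notin> D" "x \<notin> F"
    by (metis Diff_iff Un_iff countable_empty equals0I greaterThanLessThan_iff)
  show ?case
  proof (intro exI conjI allI impI)
    show "finite (insert x S)" "card (insert x S) = Suc n" "1 \<notin> insert x S" "\<forall>x\<in>insert x S. 0 < x"
      using S x by (auto simp: F_def)
    fix c :: "real \<Rightarrow> int" assume "(\<Sum>s\<in>insert 1 (insert x S). of_int (c s) * s) = 0"
    moreover have "insert 1 (insert x S) = insert x F" by (auto simp: F_def)
    ultimately have sum: "of_int (c x) * x + (\<Sum>s\<in>F. of_int (c s) * s) = 0"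
      using finF x by simp
    have "c x = 0"
    proof (rule ccontr)
      assume "c x \<noteq> 0"
      then have "x = - (\<Sum>s\<in>F. of_int (c s) * s) / of_int (c x)"
        using sum by (simp add: field_simps)
      also have "(\<Sum>s\<in>F. of_int (c s) * s) = (\<Sum>s\<in>F. of_int (restrict c F s) * s)"
        by (intro sum.cong) auto
      finally have "x \<in> D"
        unfolding D_def by (intro image_eqI[of _ _ "(c x, restrict c F)"]) auto
      then show False using x by blast
    qed
    moreover from this have "\<forall>s\<in>F. c s = 0" using ind[of c] sum by (simp add: F_def)
    ultimately show "\<forall>s\<in>insert 1 (insert x S). c s = 0" by (auto simp: F_def)
  qed
qed

text \<open>Kronecker's theorem yields an integer multiplier that may be small or negative. Adding t
  times a simultaneous Dirichlet denominator q makes it large, while the products with \<theta> move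
  modulo integers by at most t/N \<le> \<epsilon>/2. One \<theta> serves all targets, tolerances and
  thresholds.\<close>

lemma Kronecker_large_multiples:
  fixes n :: nat
  obtains \<theta> :: "nat \<Rightarrow> real" where "\<And>i. i < n \<Longrightarrow> 0 < \<theta> i"
    "\<And>\<alpha> \<epsilon> M. \<epsilon> > 0 \<Longrightarrow> \<exists>k\<ge>M. \<exists>m::nat \<Rightarrow> int. \<forall>i<n. \<bar>real k * \<theta> i - of_int (m i) - \<alpha> i\<bar> < \<epsilon>"
proof -
  obtain S where S: "finite S" "card S = n" "1 \<notin> S" "\<forall>x\<in>S. 0 < x"
    and ind: "\<And>c::real \<Rightarrow> int. (\<Sum>s\<in>insert 1 S. of_int (c s) * s) = 0 \<Longrightarrow> \<forall>s\<in>insert 1 S. c s = 0"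
    using ex_int_independent_reals[of n] by blast
  obtain g where g: "bij_betw g {0..<n} S"
    using ex_bij_betw_nat_finite[OF S(1)] S(2) by blast
  \<comment> \<open>Index n carries the number 1, so that the n + 1 values on \<open>{..n}\<close>
    are the independent family that Kronecker's theorem takes as input.\<close>
  define \<theta> where "\<theta> i = (if i < n then g i else 1)" for i
  have im: "\<theta> ` {..<n} = S" and inj: "inj_on \<theta> {..<n}"
    using g by (auto simp: bij_betw_def \<theta>_def atLeast0LessThan inj_on_def)
  have atMost: "{..n} = insert n {..<n}" by auto
  have \<theta>n: "\<theta> n = 1" by (simp add: \<theta>_def)
  have im': "\<theta> ` {..n} = insert 1 S" by (simp add: atMost im \<theta>n)
  have inj': "inj_on \<theta> {..n}" using inj im S(3) \<theta>n by (simp add: atMost)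
  \<comment> \<open>The reals as a module over the integers, for the notion of independence in
    Kronecker's theorem.\<close>
  interpret Z: Modules.module "\<lambda>(r::int) (x::real). of_int r * x"
    by unfold_locales (simp_all add: algebra_simps)
  have indep: "Z.independent (\<theta> ` {..n})"
    unfolding im' using ind S(1) by (subst Z.dependent_finite) auto
  show ?thesis
  proof (rule that[of \<theta>])
    show "0 < \<theta> i" if "i < n" for i using that im S(4) by blast
    fix \<alpha> :: "nat \<Rightarrow> real" and \<epsilon> :: real and M :: nat assume \<epsilon>: "\<epsilon> > 0"
    obtain k0 m0 where k0: "\<And>i. i < n \<Longrightarrow> \<bar>of_int k0 * \<theta> i - of_int (m0 i) - \<alpha> i\<bar> < \<epsilon> / 2"
      using Kronecker_thm_2[OF indep inj' \<theta>n, of "\<epsilon> / 2" \<alpha>] \<epsilon> by auto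
    \<comment> \<open>Since q \<ge> 1, this size of t guarantees k0 + t q \<ge> M.\<close>
    define t where "t = \<bar>k0\<bar> + int M"
    have t: "t \<ge> 0" by (simp add: t_def)
    obtain N :: nat where N: "N > 0" "of_int t / real N \<le> \<epsilon> / 2"
    proof -
      obtain N :: nat where N: "2 * of_int t / \<epsilon> < real N" using reals_Archimedean2 by blast
      moreover have "0 \<le> 2 * of_int t / \<epsilon>" using t \<epsilon> by simp
      ultimately have "N > 0" by linarith
      moreover have "of_int t / real N \<le> \<epsilon> / 2" using N \<open>N > 0\<close> \<epsilon> by (simp add: field_simps)
      ultimately show ?thesis using that by blast
    qed
    obtain q p where q: "0 < q" and qp: "\<And>i. i < n \<Longrightarrow> \<bar>of_int q * \<theta> i - of_int (p i)\<bar> < 1 / real N"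
      using Dirichlet_approx_simult[OF N(1)] by metis
    have "t * 1 \<le> t * q" using q t by (intro mult_left_mono) auto
    moreover have "int M \<le> k0 + t" by (simp add: t_def)
    ultimately have kM: "k0 + t * q \<ge> int M" by linarith
    define k where "k = nat (k0 + t * q)"
    have k: "real k = of_int k0 + of_int t * of_int q" using kM by (simp add: k_def)
    show "\<exists>k\<ge>M. \<exists>m::nat \<Rightarrow> int. \<forall>i<n. \<bar>real k * \<theta> i - of_int (m i) - \<alpha> i\<bar> < \<epsilon>"
    proof (intro exI conjI allI impI)
      show "M \<le> k" using kM by (simp add: k_def)
      fix i assume i: "i < n"
      have "\<bar>of_int t * (of_int q * \<theta> i - of_int (p i))\<bar> = of_int t * \<bar>of_int q * \<theta> i - of_int (p i)\<bar>"
        using t by (simp add: abs_mult)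
      also have "\<dots> \<le> of_int t * (1 / real N)" using qp[OF i] t by (intro mult_left_mono) auto
      also have "of_int t * (1 / real N) = of_int t / real N" by simp
      also note N(2)
      finally have "\<bar>of_int t * (of_int q * \<theta> i - of_int (p i))\<bar> \<le> \<epsilon> / 2" .
      moreover have "real k * \<theta> i = real_of_int k0 * \<theta> i + real_of_int t * (real_of_int q * \<theta> i)"
        unfolding k by (simp only: distrib_right mult.assoc)
      moreover have "real_of_int (m0 i + t * p i) = real_of_int (m0 i) + real_of_int t * real_of_int (p i)"
        by simp
      ultimately show "\<bar>real k * \<theta> i - of_int (m0 i + t * p i) - \<alpha> i\<bar> < \<epsilon>"
        using k0[OF i] unfolding right_diff_distrib by linarith
    qed
  qed
qed

lemma subsemigroup_gen_subset_subgroup_gen: "subsemigroup_gen A \<subseteq> subgroup_gen A"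
proof
  fix x assume "x \<in> subsemigroup_gen A"
  then show "x \<in> subgroup_gen A"
  proof induction
    case (add x y)
    have "x - (0 - y) \<in> subgroup_gen A"
      using add.IH by (intro subgroup_gen.diff subgroup_gen.zero)
    then show ?case by simp
  qed (rule subgroup_gen.gen)
qed

section \<open>A finitely generated dense subsemigroup\<close>

context vector_cover
begin

lemma nat_multiple_mem_subsemigroup_gen:
  assumes "E v \<in> A"
  shows "x \<in> subsemigroup_gen A \<Longrightarrow> x + E (real n *\<^sub>R v) \<in> subsemigroup_gen A"
proof (induction n)
  case 0
  then show ?case by (simp add: zero)
next
  case (Suc n)
  have "E (real (Suc n) *\<^sub>R v) = E (real n *\<^sub>R v) + E v"
    by (simp add: scaleR_add_left add add.commute)
  then show ?case
    using Suc subsemigroup_gen.add[OF Suc.IH[OF Suc.prems] subsemigroup_gen.gen[OF assms]]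
    by (simp add: add.assoc)
qed

text \<open>Multiples k w, corrected by integer combinations of the basis \<open>B\<close>, come
  arbitrarily close to every vector. Under \<open>E\<close> the corrections along periods disappear
  and those along \<open>B - C\<close> have nonnegative coefficients, so \<open>E w\<close> and the
  images of \<open>B - C\<close> suffice.\<close>

lemma dense_subsemigroup_exists:
  obtains A :: "'g set" where "finite A" "card A + dim periods \<le> DIM('e) + 1" "closure (subsemigroup_gen A) = UNIV"
proof -
  obtain C where C: "C \<subseteq> periods" "independent C" "periods \<subseteq> span C" "card C = dim periods"
    using basis_exists by blast
  obtain B where B: "C \<subseteq> B" "independent B" "UNIV \<subseteq> span B"
    using maximal_independent_subset_extend[of C UNIV] C(2) by auto
  have fin: "finite B" using B(2) independent_imp_finite by blast
  have cardB: "card B = DIM('e)"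
    using dim_eq_card[of B UNIV] B by (simp add: top.extremum_unique)
  obtain idx where idx: "bij_betw idx B {0..<card B}"
    using ex_bij_betw_finite_nat[OF fin] by blast
  have idx_less: "idx b < card B" if "b \<in> B" for b
    using idx that by (auto simp: bij_betw_def)
  obtain \<theta> where \<theta>: "\<And>i. i < card B \<Longrightarrow> 0 < \<theta> i"
    and kron: "\<And>\<alpha> \<epsilon> M. \<epsilon> > 0 \<Longrightarrow> \<exists>k\<ge>M. \<exists>m::nat \<Rightarrow> int. \<forall>i<card B. \<bar>real k * \<theta> i - of_int (m i) - \<alpha> i\<bar> < \<epsilon>"
    using Kronecker_large_multiples by metis
  define \<tau> where "\<tau> b = \<theta> (idx b)" for b
  \<comment> \<open>Outside \<open>C\<close> the coordinates of \<open>w\<close> are negative, so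
    for large k the integer correction bringing k w back to a bounded target is a positive multiple
    of b. Within \<open>C\<close> the sign of the correction is irrelevant, as integer multiples of
    periods are killed by \<open>E\<close>.\<close>
  define \<sigma> :: "'e \<Rightarrow> real" where "\<sigma> b = (if b \<in> C then 1 else - 1)" for b
  have \<sigma>: "\<sigma> b * \<sigma> b = 1" "\<bar>\<sigma> b\<bar> = 1" for b by (auto simp: \<sigma>_def)
  have \<tau>: "\<tau> b > 0" if "b \<in> B" for b using \<theta> idx_less that by (simp add: \<tau>_def)
  define w where "w = (\<Sum>b\<in>B. (\<sigma> b * \<tau> b) *\<^sub>R b)"
  define A where "A = insert (E w) (E ` (B - C))"
  have approx: "\<exists>y. norm (y - v) < \<epsilon> \<and> E y \<in> subsemigroup_gen A" if \<epsilon>: "\<epsilon> > 0" for v \<epsilon>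
  proof -
    have "v \<in> span B" using B(3) by blast
    then obtain x where x: "v = (\<Sum>b\<in>B. x b *\<^sub>R b)" using fin by (auto simp: span_finite)
    \<comment> \<open>The summand 1 keeps \<open>R\<close> positive and makes the final estimate
      \<delta> (R - 1) < \<epsilon> strict.\<close>
    define R where "R = 1 + (\<Sum>b\<in>B. norm b)"
    have R: "R > 0" unfolding R_def by (smt (verit) norm_ge_zero sum_nonneg)
    define \<delta> where "\<delta> = \<epsilon> / R"
    have \<delta>: "\<delta> > 0" using \<epsilon> R by (simp add: \<delta>_def)
    \<comment> \<open>Beyond this threshold k \<tau> exceeds the target coordinate plus the
      tolerance for every b, which forces the integers \<open>m b\<close> to be positive.\<close>
    obtain M :: nat where M: "(\<Sum>b\<in>B. (\<bar>x b\<bar> + \<delta>) / \<tau> b) < real M" using reals_Archimedean2 by blast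
    define \<alpha> where "\<alpha> i = (let b = inv_into B idx i in \<sigma> b * x b)" for i
    have \<alpha>: "\<alpha> (idx b) = \<sigma> b * x b" if "b \<in> B" for b
      using that idx by (simp add: \<alpha>_def bij_betw_def inv_into_f_f)
    \<comment> \<open>\<open>Suc M\<close> also gives k \<ge> 1, so that k times \<open>E w\<close>
      lies in the subsemigroup, which need not contain 0 a priori.\<close>
    obtain k m' where k: "k \<ge> Suc M"
      and m': "\<forall>i<card B. \<bar>real k * \<theta> i - of_int (m' i) - \<alpha> i\<bar> < \<delta>"
      using kron[OF \<delta>] by blast
    define m where "m b = m' (idx b)" for b
    have m: "\<bar>real k * \<tau> b - of_int (m b) - \<sigma> b * x b\<bar> < \<delta>" if "b \<in> B" for b
      using m' idx_less[OF that] \<alpha>[OF that] by (auto simp: m_def \<tau>_def)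
    have m_nonneg: "m b \<ge> 0" if b: "b \<in> B - C" for b
    proof -
      have "(\<bar>x b\<bar> + \<delta>) / \<tau> b \<le> (\<Sum>b\<in>B. (\<bar>x b\<bar> + \<delta>) / \<tau> b)"
        using b fin \<tau> \<delta> by (intro member_le_sum) (auto intro!: divide_nonneg_pos)
      also have "\<dots> < real k" using M k by linarith
      finally have "\<bar>x b\<bar> + \<delta> < real k * \<tau> b" using \<tau>[of b] b by (simp add: field_simps)
      moreover have "\<bar>\<sigma> b * x b\<bar> = \<bar>x b\<bar>" by (simp add: abs_mult \<sigma>)
      ultimately have "of_int (m b) > (0 :: real)" using m[of b] DiffD1[OF b] by linarith
      then show ?thesis by simp
    qed
    define y where "y = real k *\<^sub>R w - (\<Sum>b\<in>B. (\<sigma> b * of_int (m b)) *\<^sub>R b)"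
    have "y - v = (\<Sum>b\<in>B. (\<sigma> b * (real k * \<tau> b - of_int (m b) - \<sigma> b * x b)) *\<^sub>R b)"
    proof -
      have "(\<sigma> b * (real k * \<tau> b - of_int (m b) - \<sigma> b * x b)) *\<^sub>R b
          = real k *\<^sub>R ((\<sigma> b * \<tau> b) *\<^sub>R b) - (\<sigma> b * of_int (m b)) *\<^sub>R b - x b *\<^sub>R b" for b
      proof -
        have "\<sigma> b * (real k * \<tau> b - of_int (m b) - \<sigma> b * x b)
            = real k * (\<sigma> b * \<tau> b) - \<sigma> b * of_int (m b) - (\<sigma> b * \<sigma> b) * x b"
          by (simp add: algebra_simps)
        then show ?thesis by (simp add: \<sigma> scaleR_diff_left)
      qed
      then show ?thesis
        unfolding y_def x w_def by (simp add: sum_subtractf scaleR_sum_right)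
    qed
    also have "norm \<dots> \<le> (\<Sum>b\<in>B. \<delta> * norm b)"
    proof (rule sum_norm_le)
      fix b assume "b \<in> B"
      then have "\<bar>real k * \<tau> b - of_int (m b) - \<sigma> b * x b\<bar> \<le> \<delta>" using m by (simp add: less_imp_le)
      then show "norm ((\<sigma> b * (real k * \<tau> b - of_int (m b) - \<sigma> b * x b)) *\<^sub>R b) \<le> \<delta> * norm b"
        by (simp add: abs_mult \<sigma> mult_right_mono)
    qed
    also have "\<dots> = \<delta> * (R - 1)" by (simp add: R_def sum_distrib_left)
    also have "\<dots> < \<delta> * R" using \<delta> by simp
    also have "\<dots> = \<epsilon>" using R by (simp add: \<delta>_def)
    finally have near: "norm (y - v) < \<epsilon>" .
    have "E (\<Sum>b\<in>B. (\<sigma> b * of_int (m b)) *\<^sub>R b) = (\<Sum>b\<in>B. E ((\<sigma> b * of_int (m b)) *\<^sub>R b))"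
      by (rule sum)
    also have "\<dots> = (\<Sum>b\<in>B - C. E ((\<sigma> b * of_int (m b)) *\<^sub>R b))"
    proof (rule sum.mono_neutral_right[OF fin])
      show "\<forall>b\<in>B - (B - C). E ((\<sigma> b * of_int (m b)) *\<^sub>R b) = 0"
        using C(1) int_multiple_periods by (auto simp: \<sigma>_def periods_def)
    qed auto
    also have "\<dots> = (\<Sum>b\<in>B - C. - E (real (nat (m b)) *\<^sub>R b))"
      using m_nonneg by (intro sum.cong) (auto simp: \<sigma>_def simp flip: minus)
    finally have Ey: "E y = E (real k *\<^sub>R w) + (\<Sum>b\<in>B - C. E (real (nat (m b)) *\<^sub>R b))"
      by (simp add: y_def diff sum_negf)
    have w: "E w \<in> A" by (simp add: A_def)
    have "E (real k *\<^sub>R w) = E w + E (real (k - 1) *\<^sub>R w)"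
    proof -
      have "real k *\<^sub>R w = w + real (k - 1) *\<^sub>R w"
        using k by (simp add: of_nat_diff scaleR_diff_left)
      then show ?thesis by (simp add: add)
    qed
    then have kw: "E (real k *\<^sub>R w) \<in> subsemigroup_gen A"
      using nat_multiple_mem_subsemigroup_gen[OF w subsemigroup_gen.gen[OF w]] by simp
    have "E (real k *\<^sub>R w) + (\<Sum>b\<in>F. E (real (nat (m b)) *\<^sub>R b)) \<in> subsemigroup_gen A"
      if "finite F" "F \<subseteq> B - C" for F
      using that
    proof (induction F rule: finite_induct)
      case empty
      then show ?case using kw by simp
    next
      case (insert b F)
      then have "E b \<in> A" by (auto simp: A_def)
      then have "(E (real k *\<^sub>R w) + (\<Sum>b\<in>F. E (real (nat (m b)) *\<^sub>R b))) + E (real (nat (m b)) *\<^sub>R b) \<in> subsemigroup_gen A"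
        using insert by (intro nat_multiple_mem_subsemigroup_gen) auto
      then show ?case using insert by (simp add: add_ac)
    qed
    then have "E y \<in> subsemigroup_gen A" unfolding Ey using fin by simp
    then show ?thesis using near by blast
  qed
  show ?thesis
  proof
    show "finite A" using fin by (simp add: A_def)
    have "card A \<le> Suc (card (E ` (B - C)))" unfolding A_def by (rule card_insert_le_m1) auto
    also have "\<dots> \<le> Suc (card (B - C))" using fin by (simp add: card_image_le)
    also have "card (B - C) = card B - card C"
      using B(1) fin by (simp add: card_Diff_subset finite_subset)
    finally show "card A + dim periods \<le> DIM('e) + 1"
      using cardB C(4) card_mono[OF fin B(1)] by linarith
    show "closure (subsemigroup_gen A) = UNIV"
    proof (rule ccontr)
      assume "closure (subsemigroup_gen A) \<noteq> UNIV"
      then obtain v where v: "E v \<notin> closure (subsemigroup_gen A)" using surj by (metis UNIV_eq_I surjD)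
      define U where "U = E -` (- closure (subsemigroup_gen A))"
      have "open U" unfolding U_def using cont by (intro open_vimage) auto
      moreover have "v \<in> U" using v by (simp add: U_def)
      ultimately obtain \<epsilon> where \<epsilon>: "\<epsilon> > 0" "ball v \<epsilon> \<subseteq> U" using open_contains_ball by blast
      obtain y where y: "norm (y - v) < \<epsilon>" "E y \<in> subsemigroup_gen A" using approx[OF \<epsilon>(1)] by blast
      then have "y \<in> U" using \<epsilon>(2) by (auto simp: dist_norm norm_minus_commute)
      then show False using y(2) closure_subset by (auto simp: U_def)
    qed
  qed
qed

end

theorem theorem4p1:
  fixes A :: "('g::{topological_ab_group_add,t2_space} set \<times> ('g \<Rightarrow> 'e::euclidean_space)) set"
    and T :: "'g set" and d :: nat
  assumes "lie_group_atlas A"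
    and "connected (UNIV :: 'g set)"
    and "UNIV \<noteq> {0 :: 'g}"
    and "maximal_compact_subgroup T"
    and "locally_euclidean_dim (quotient_top T) d"
  shows "d_gr TYPE('g) = enat (d + 1) \<and> d_m TYPE('g) = enat (d + 1)"
proof -
  obtain E :: "'e \<Rightarrow> 'g" where "vector_cover E"
    using lie_group_atlas_vector_cover[OF assms(1,2)] by blast
  then interpret vector_cover E .
  have d: "d + dim periods = DIM('e)"
    using assms(4,5) by (rule quotient_dimension)
  \<comment> \<open>Infinite sets satisfy the bound because their \<open>ecard\<close> is infinite.
    Through \<open>mono\<close> it also covers generators of dense subsemigroups, and a single
    \<open>X\<close> attains it for both invariants.\<close>
  have lower: "enat (d + 1) \<le> ecard X" if "closure (subgroup_gen X) = UNIV" for X :: "'g set"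
    using card_dense_generators_gt[OF assms(3) _ that] d by (auto simp: ecard_def)
  have mono: "closure (subgroup_gen X) = UNIV" if "closure (subsemigroup_gen X) = UNIV" for X :: "'g set"
    using closure_mono[OF subsemigroup_gen_subset_subgroup_gen[of X]] that by auto
  obtain X :: "'g set" where X: "finite X" "card X + dim periods \<le> DIM('e) + 1"
    "closure (subsemigroup_gen X) = UNIV"
    by (rule dense_subsemigroup_exists)
  have upper: "ecard X \<le> enat (d + 1)"
    using X(1,2) d by (simp add: ecard_def)
  have "d_gr TYPE('g) \<le> enat (d + 1)"
    unfolding d_gr_def using X(3) mono upper by (intro Inf_lower2[of "ecard X"]) auto
  moreover have "d_m TYPE('g) \<le> enat (d + 1)"
    unfolding d_m_def using X(3) upper by (intro Inf_lower2[of "ecard X"]) auto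
  moreover have "enat (d + 1) \<le> d_gr TYPE('g)"
    unfolding d_gr_def using lower by (intro Inf_greatest) auto
  moreover have "enat (d + 1) \<le> d_m TYPE('g)"
    unfolding d_m_def using lower mono by (intro Inf_greatest) auto
  ultimately show ?thesis by (simp add: order_antisym)
qed

end
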